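(* Consider an instance of the minimum crossing lattice polyhedron problem (defined in the context) in which the lattice is ordered by inclusion, i.e. $S\le T$ if and only if $\rho(S)\subseteq\rho(T)$ for all $S,T\in\mathcal{F}$, and only upper degree bounds are given (constraints $x(E_i)\le b_i$, $i\in I$). Let $\Delta=\max_{e\in E}|\{i\in I: e\in E_i\}|$. Then there is an algorithm that computes $x\in\{0,1\}^E$ of cost at most the optimal cost, satisfying all rank constraints $x(\rho(S))\ge r(S)$ for $S\in\mathcal{F}$, with $x(E_i)\le b_i+\Delta-1$ for all $i\in I$.
   Context: Let $(\mathcal{F},\le)$ be a nonempty partially ordered set equipped with two commutative binary operations, meet $\wedge$ and join $\vee$, defined on all pairs, such that $A\wedge B\le A,B\le A\vee B$. A function $r:\mathcal{F}\to\mathbb{Z}_{\ge0}$ is supermodular if $r(A)+r(B)\le r(A\wedge B)+r(A\vee B)$ for all $A,B$. Let $E$ be a finite ground set, $c:E\to\mathbb{R}_{\ge0}$, and $\rho:\mathcal{F}\to2^E$ satisfy $A\le B\le C\Rightarrow\rho(A)\cap\rho(C)\subseteq\rho(B)$ and $\rho(A\vee B)\cup\rho(A\wedge B)\subseteq\rho(A)\cup\rho(B)$. Given subsets $\{E_i\subseteq E\}_{i\in I}$ with bounds, the minimum crossing lattice polyhedron problem minimizes $c^Tx$ over $x\in\{0,1\}^E$ with $x(\rho(S))\ge r(S)$ for all $S\in\mathcal{F}$ and the degree constraints on the $x(E_i)$, where $x(A)=\sum_{e\in A}x_e$.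
   Formalization: The additive violation is max(0, Δ−1) instead of Δ−1: for Δ = 0 (all E_i empty) the bound x(E_i) ≤ b_i − 1 fails when b_i = 0. For Δ ≥ 1 nothing changes. The bounds b_i are taken to be integers. *)

theory Defs
  imports "HOL-Analysis.Analysis"
begin

section \<open>Crossing lattice polyhedron problem with upper degree bounds\<close>

record ('f, 'e, 'i) clp =
  clp_family :: "'f set"
  clp_le :: "'f \<Rightarrow> 'f \<Rightarrow> bool"
  clp_meet :: "'f \<Rightarrow> 'f \<Rightarrow> 'f"
  clp_join :: "'f \<Rightarrow> 'f \<Rightarrow> 'f"
  clp_rank :: "'f \<Rightarrow> nat"
  clp_ground :: "'e set"
  clp_weight :: "'e \<Rightarrow> real"
  clp_rho :: "'f \<Rightarrow> 'e set"
  clp_index :: "'i set"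
  clp_deg_set :: "'i \<Rightarrow> 'e set"
  clp_bound :: "'i \<Rightarrow> int"

text \<open>
  Meet and join are only required to be commutative lower and upper bounds, not greatest lower and
  least upper bounds.
\<close>

definition clp_lattice :: "('f, 'e, 'i) clp \<Rightarrow> bool" where
  "clp_lattice L \<longleftrightarrow>
     clp_family L \<noteq> {} \<and>
     reflp_on (clp_family L) (clp_le L) \<and>
     transp_on (clp_family L) (clp_le L) \<and>
     antisymp_on (clp_family L) (clp_le L) \<and>
     (\<forall>A\<in>clp_family L. \<forall>B\<in>clp_family L.
        clp_meet L A B \<in> clp_family L \<and> clp_join L A B \<in> clp_family L \<and>
        clp_meet L A B = clp_meet L B A \<and> clp_join L A B = clp_join L B A \<and>
        clp_le L (clp_meet L A B) A \<and> clp_le L (clp_meet L A B) B \<and>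
        clp_le L A (clp_join L A B) \<and> clp_le L B (clp_join L A B))"

definition clp_supermodular :: "('f, 'e, 'i) clp \<Rightarrow> bool" where
  "clp_supermodular L \<longleftrightarrow>
     (\<forall>A\<in>clp_family L. \<forall>B\<in>clp_family L.
        clp_rank L A + clp_rank L B \<le> clp_rank L (clp_meet L A B) + clp_rank L (clp_join L A B))"

definition clp_consecutive :: "('f, 'e, 'i) clp \<Rightarrow> bool" where
  "clp_consecutive L \<longleftrightarrow>
     (\<forall>A\<in>clp_family L. \<forall>B\<in>clp_family L. \<forall>C\<in>clp_family L.
        clp_le L A B \<and> clp_le L B C \<longrightarrow> clp_rho L A \<inter> clp_rho L C \<subseteq> clp_rho L B)"

definition clp_submodular :: "('f, 'e, 'i) clp \<Rightarrow> bool" where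
  "clp_submodular L \<longleftrightarrow>
     (\<forall>A\<in>clp_family L. \<forall>B\<in>clp_family L.
        clp_rho L (clp_join L A B) \<union> clp_rho L (clp_meet L A B) \<subseteq> clp_rho L A \<union> clp_rho L B)"

definition clp_instance :: "('f, 'e, 'i) clp \<Rightarrow> bool" where
  "clp_instance L \<longleftrightarrow>
     clp_lattice L \<and> clp_supermodular L \<and>
     finite (clp_ground L) \<and>
     (\<forall>e\<in>clp_ground L. 0 \<le> clp_weight L e) \<and>
     (\<forall>S\<in>clp_family L. clp_rho L S \<subseteq> clp_ground L) \<and>
     clp_consecutive L \<and> clp_submodular L \<and>
     finite (clp_index L) \<and>
     (\<forall>i\<in>clp_index L. clp_deg_set L i \<subseteq> clp_ground L)"

definition clp_inclusion_ordered :: "('f, 'e, 'i) clp \<Rightarrow> bool" where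
  "clp_inclusion_ordered L \<longleftrightarrow>
     (\<forall>S\<in>clp_family L. \<forall>T\<in>clp_family L. clp_le L S T \<longleftrightarrow> clp_rho L S \<subseteq> clp_rho L T)"

definition clp_cost :: "('f, 'e, 'i) clp \<Rightarrow> ('e \<Rightarrow> real) \<Rightarrow> real" where
  "clp_cost L x = (\<Sum>e\<in>clp_ground L. clp_weight L e * x e)"

definition clp_rank_ok :: "('f, 'e, 'i) clp \<Rightarrow> ('e \<Rightarrow> real) \<Rightarrow> bool" where
  "clp_rank_ok L x \<longleftrightarrow> (\<forall>S\<in>clp_family L. real (clp_rank L S) \<le> sum x (clp_rho L S))"

text \<open>
  Feasible vectors with coordinates in \<open>D\<close>: the problem itself is \<open>D = {0, 1}\<close>, and
  \<open>D = {0..1}\<close> is its linear relaxation.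
\<close>

definition clp_feasible :: "('f, 'e, 'i) clp \<Rightarrow> real set \<Rightarrow> ('e \<Rightarrow> real) set" where
  "clp_feasible L D = {x \<in> clp_ground L \<rightarrow> D. clp_rank_ok L x \<and>
     (\<forall>i\<in>clp_index L. sum x (clp_deg_set L i) \<le> of_int (clp_bound L i))}"

text \<open>Meaningful when \<open>clp_feasible L D\<close> is nonempty; costs are then bounded below by 0.\<close>

definition clp_opt :: "('f, 'e, 'i) clp \<Rightarrow> real set \<Rightarrow> real" where
  "clp_opt L D = (INF x\<in>clp_feasible L D. clp_cost L x)"

text \<open>The inserted 0 only matters for an empty ground set.\<close>

definition clp_Delta :: "('f, 'e, 'i) clp \<Rightarrow> nat" where
  "clp_Delta L =
     Max (insert 0 ((\<lambda>e. card {i \<in> clp_index L. e \<in> clp_deg_set L i}) ` clp_ground L))"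

text \<open>
  Rank constraints hold exactly and degree bounds up to an additive \<open>\<Delta> - 1\<close>. The truncation at 0
  only matters if \<open>\<Delta> = 0\<close>, when all degree sets are empty and no vector can satisfy the bound
  \<open>b i - 1\<close> for \<open>b i = 0\<close>.
\<close>

definition clp_near_feasible :: "('f, 'e, 'i) clp \<Rightarrow> ('e \<Rightarrow> real) \<Rightarrow> bool" where
  "clp_near_feasible L x \<longleftrightarrow>
     x \<in> clp_ground L \<rightarrow> {0, 1} \<and> clp_rank_ok L x \<and>
     (\<forall>i\<in>clp_index L.
        sum x (clp_deg_set L i) \<le> of_int (clp_bound L i) + max 0 (real (clp_Delta L) - 1))"

text \<open>
  In the inclusion-ordered case the family is finite, so such an instance is a finite input.
\<close>

lemma clp_finite_family:
  assumes "clp_instance L" and "clp_inclusion_ordered L"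
  shows "finite (clp_family L)"
proof (rule inj_on_finite)
  show "inj_on (clp_rho L) (clp_family L)"
    using assms unfolding inj_on_def clp_instance_def clp_lattice_def clp_inclusion_ordered_def
    by (metis antisymp_onD order_refl)
  show "clp_rho L ` clp_family L \<subseteq> Pow (clp_ground L)"
    using assms unfolding clp_instance_def by blast
  show "finite (Pow (clp_ground L))"
    using assms unfolding clp_instance_def by simp
qed


section \<open>Algorithms as programs over exact integers and reals\<close>

text \<open>
  The weights are arbitrary reals, so algorithms are programs of the usual real-number model: memory
  consists of named integer arrays and named real arrays, arithmetic and comparisons are exact, and
  the only constants in a program are integers. A scalar is cell 0 of an array.
\<close>

datatype iexp =
    IConst int
  | ICell string iexp
  | IAdd iexp iexp
  | ISub iexp iexp
  | IMul iexp iexp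

datatype rexp =
    ROfInt iexp
  | RCell string iexp
  | RAdd rexp rexp
  | RSub rexp rexp
  | RMul rexp rexp
  | RDiv rexp rexp

datatype test =
    ILess iexp iexp
  | RLess rexp rexp
  | TNot test
  | TAnd test test

datatype prog =
    PSkip
  | PISet string iexp iexp
  | PRSet string iexp rexp
  | PSeq prog prog
  | PIf test prog prog
  | PWhile test prog

record mem =
  imem :: "string \<Rightarrow> int \<Rightarrow> int"
  rmem :: "string \<Rightarrow> int \<Rightarrow> real"

primrec ival :: "iexp \<Rightarrow> mem \<Rightarrow> int" where
  "ival (IConst k) s = k"
| "ival (ICell v a) s = imem s v (ival a s)"
| "ival (IAdd a b) s = ival a s + ival b s"
| "ival (ISub a b) s = ival a s - ival b s"
| "ival (IMul a b) s = ival a s * ival b s"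

primrec rval :: "rexp \<Rightarrow> mem \<Rightarrow> real" where
  "rval (ROfInt a) s = of_int (ival a s)"
| "rval (RCell v a) s = rmem s v (ival a s)"
| "rval (RAdd a b) s = rval a s + rval b s"
| "rval (RSub a b) s = rval a s - rval b s"
| "rval (RMul a b) s = rval a s * rval b s"
| "rval (RDiv a b) s = rval a s / rval b s"

primrec holds :: "test \<Rightarrow> mem \<Rightarrow> bool" where
  "holds (ILess a b) s \<longleftrightarrow> ival a s < ival b s"
| "holds (RLess a b) s \<longleftrightarrow> rval a s < rval b s"
| "holds (TNot t) s \<longleftrightarrow> \<not> holds t s"
| "holds (TAnd t u) s \<longleftrightarrow> holds t s \<and> holds u s"

definition iput :: "string \<Rightarrow> int \<Rightarrow> int \<Rightarrow> mem \<Rightarrow> mem" where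
  "iput v k z s = s\<lparr>imem := (imem s)(v := (imem s v)(k := z))\<rparr>"

definition rput :: "string \<Rightarrow> int \<Rightarrow> real \<Rightarrow> mem \<Rightarrow> mem" where
  "rput v k z s = s\<lparr>rmem := (rmem s)(v := (rmem s v)(k := z))\<rparr>"

text \<open>\<open>terminates_in p s t\<close>: started in memory \<open>s\<close>, the program \<open>p\<close> halts in memory \<open>t\<close>.\<close>

inductive terminates_in :: "prog \<Rightarrow> mem \<Rightarrow> mem \<Rightarrow> bool" where
  skip: "terminates_in PSkip s s"
| iset: "terminates_in (PISet v a b) s (iput v (ival a s) (ival b s) s)"
| rset: "terminates_in (PRSet v a b) s (rput v (ival a s) (rval b s) s)"
| seq: "terminates_in p s t \<Longrightarrow> terminates_in q t u \<Longrightarrow> terminates_in (PSeq p q) s u"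
| if_true: "holds b s \<Longrightarrow> terminates_in p s t \<Longrightarrow> terminates_in (PIf b p q) s t"
| if_false: "\<not> holds b s \<Longrightarrow> terminates_in q s t \<Longrightarrow> terminates_in (PIf b p q) s t"
| while_false: "\<not> holds b s \<Longrightarrow> terminates_in (PWhile b p) s s"
| while_true: "holds b s \<Longrightarrow> terminates_in p s t \<Longrightarrow> terminates_in (PWhile b p) t u \<Longrightarrow>
    terminates_in (PWhile b p) s u"

inductive_cases skipE: "terminates_in PSkip s t"
inductive_cases isetE: "terminates_in (PISet v a b) s t"
inductive_cases rsetE: "terminates_in (PRSet v a b) s t"
inductive_cases seqE: "terminates_in (PSeq p q) s t"
inductive_cases ifE: "terminates_in (PIf b p q) s t"
inductive_cases whileE: "terminates_in (PWhile b p) s t"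

lemma terminates_in_deterministic:
  "terminates_in p s t \<Longrightarrow> terminates_in p s u \<Longrightarrow> u = t"
proof (induction arbitrary: u rule: terminates_in.induct)
  case skip
  then show ?case by (rule skipE)
next
  case iset
  then show ?case by (rule isetE)
next
  case rset
  then show ?case by (rule rsetE)
next
  case seq
  from seq.prems show ?case by (rule seqE) (use seq.IH in blast)
next
  case if_true
  from if_true.prems show ?case by (rule ifE) (use if_true in blast)+
next
  case if_false
  from if_false.prems show ?case by (rule ifE) (use if_false in blast)+
next
  case while_false
  from while_false.prems show ?case by (rule whileE) (use while_false in blast)+
next
  case while_true
  from while_true.prems show ?case by (rule whileE) (use while_true in blast)+
qed

text \<open>
  Input format. The three lists enumerate ground set, family and degree constraints. The sets
  \<open>\<rho>(S)\<close> and \<open>E\<^sub>i\<close> are given by 0/1 incidence matrices, stored row by row. The order and the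
  lattice operations are not passed to the program, and cells not mentioned are arbitrary.
\<close>

definition clp_loaded ::
    "('f, 'e, 'i) clp \<Rightarrow> 'e list \<Rightarrow> 'f list \<Rightarrow> 'i list \<Rightarrow> mem \<Rightarrow> bool" where
  "clp_loaded L es fs js s \<longleftrightarrow>
     distinct es \<and> set es = clp_ground L \<and>
     distinct fs \<and> set fs = clp_family L \<and>
     distinct js \<and> set js = clp_index L \<and>
     imem s ''n'' 0 = int (length es) \<and>
     imem s ''m'' 0 = int (length fs) \<and>
     imem s ''k'' 0 = int (length js) \<and>
     (\<forall>j<length es. rmem s ''c'' (int j) = clp_weight L (es ! j)) \<and>
     (\<forall>a<length fs. imem s ''r'' (int a) = int (clp_rank L (fs ! a))) \<and>
     (\<forall>a<length fs. \<forall>j<length es.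
        imem s ''rho'' (int (a * length es + j)) = of_bool (es ! j \<in> clp_rho L (fs ! a))) \<and>
     (\<forall>a<length js. imem s ''b'' (int a) = clp_bound L (js ! a)) \<and>
     (\<forall>a<length js. \<forall>j<length es.
        imem s ''E'' (int (a * length es + j)) = of_bool (es ! j \<in> clp_deg_set L (js ! a)))"

text \<open>Output format: the coordinates of \<open>x\<close>, in the order in which the ground set was given.\<close>

definition clp_output :: "'e list \<Rightarrow> mem \<Rightarrow> ('e \<Rightarrow> real) \<Rightarrow> bool" where
  "clp_output es t x \<longleftrightarrow> (\<forall>j<length es. x (es ! j) = of_int (imem t ''x'' (int j)))"

end

theory Submission
  imports Defs "HOL-Library.Nat_Bijection"
begin

text \<open>
  Existence of a good rounding comes from iterative relaxation. Under the inclusion order the sets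
  \<open>\<rho>(S)\<close> of tight rank constraints, restricted to the support of \<open>x\<close>, form a ring of sets, so they
  are spanned by a chain; consecutive members of the chain differ in \<open>x\<close>-weight by a positive
  integer, so its length is at most the \<open>x\<close>-weight of its top. If every degree set \<open>E i\<close> still under
  consideration has at least \<open>b i + \<Delta>\<close> support elements, then double counting of \<open>1 - x e\<close> bounds the
  number of tight ones by the number of fractional coordinates minus that weight. The tight
  constraints therefore leave a direction free along which \<open>x\<close> can be moved.

  The problem asks for no running time bound, so the program is an exhaustive search over all 0/1
  vectors for a cheapest one that satisfies the relaxed constraints.
\<close>

section \<open>Rounding by iterative relaxation\<close>

text \<open>For \<open>\<Delta> \<ge> 1\<close> the threshold \<open>b i + \<Delta>\<close> is the
  borderline of the count. In a tight degree set with that many support elements the values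
  \<open>1 - x e\<close> add up to at least \<open>\<Delta>\<close>, while an element passes its
  value to at most \<open>\<Delta>\<close> such sets. So tight degree sets number at most
  \<open>|U| - x(U)\<close>, with \<open>U\<close> the fractional coordinates, and the chain takes
  at most \<open>x(U)\<close> more. The total may reach \<open>|U|\<close>, so the equality case has
  to yield a linear dependency.

  The loss \<open>\<Delta> - 1\<close> comes from integrality: a degree set is given up once its
  support has fewer than \<open>b i + \<Delta>\<close> elements, hence at most
  \<open>b i + \<Delta> - 1\<close>, and coordinates at 0 never leave 0, so nothing outside that
  support is selected later.

  Rounding every feasible point of the relaxation, rather than an optimal extreme point, bounds the
  result of the search by the infimum of the relaxed costs without any claim that it is
  attained.\<close>

lemma homogeneous_system_nontrivial_solution:
  fixes w :: "'i \<Rightarrow> 'e \<Rightarrow> real"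
  assumes "finite I" "finite U" "card I < card U"
  shows "\<exists>d. (\<forall>e. e \<notin> U \<longrightarrow> d e = 0) \<and> (\<exists>e\<in>U. d e \<noteq> 0) \<and> (\<forall>i\<in>I. (\<Sum>e\<in>U. w i e * d e) = 0)"
  using assms
proof (induction I arbitrary: w U rule: finite_induct)
  case empty
  then obtain u where "u \<in> U" by fastforce
  then show ?case by (intro exI[of _ "\<lambda>e. if e = u then 1 else 0"]) auto
next
  case (insert i I)
  show ?case
  proof (cases "\<forall>e\<in>U. w i e = 0")
    case True
    obtain d where "\<forall>e. e \<notin> U \<longrightarrow> d e = 0" "\<exists>e\<in>U. d e \<noteq> 0" "\<forall>i\<in>I. (\<Sum>e\<in>U. w i e * d e) = 0"
      using insert.IH[of U w] insert.prems insert.hyps by auto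
    with True show ?thesis by (intro exI[of _ d]) auto
  next
    case False
    then obtain u where u: "u \<in> U" "w i u \<noteq> 0" by blast
    define V where "V = U - {u}"
    have V: "finite V" "u \<notin> V" "U = insert u V" "card I < card V"
      using insert.prems insert.hyps u by (auto simp: V_def)
    \<comment> \<open>Gaussian elimination: subtracting multiples of the pivot equation
      \<open>i\<close> removes the unknown \<open>u\<close> from all others; \<open>z\<close> below
      solves equation \<open>i\<close> for \<open>u\<close>.\<close>
    obtain d where d: "\<forall>e. e \<notin> V \<longrightarrow> d e = 0" "\<exists>e\<in>V. d e \<noteq> 0"
      "\<forall>k\<in>I. (\<Sum>e\<in>V. (w k e - w k u / w i u * w i e) * d e) = 0"
      using insert.IH[of V "\<lambda>k e. w k e - w k u / w i u * w i e"] V by blast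
    define z where "z = - (\<Sum>e\<in>V. w i e * d e) / w i u"
    have split: "(\<Sum>e\<in>U. w k e * (d(u := z)) e) = w k u * z + (\<Sum>e\<in>V. w k e * d e)" for k
    proof -
      have "(\<Sum>e\<in>V. w k e * (d(u := z)) e) = (\<Sum>e\<in>V. w k e * d e)"
        using V by (intro sum.cong) auto
      then show ?thesis using V by simp
    qed
    have "(\<Sum>e\<in>U. w k e * (d(u := z)) e) = 0" if "k \<in> insert i I" for k
    proof (cases "k = i")
      case True
      then show ?thesis using u by (simp only: split) (simp add: z_def)
    next
      case False
      then have "0 = (\<Sum>e\<in>V. w k e * d e - w k u / w i u * (w i e * d e))"
        using d(3) that by (auto simp: algebra_simps)
      also have "\<dots> = (\<Sum>e\<in>V. w k e * d e) - w k u / w i u * (\<Sum>e\<in>V. w i e * d e)"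
        by (simp add: sum_subtractf sum_distrib_left)
      finally show ?thesis by (simp only: split) (simp add: z_def)
    qed
    moreover have "\<exists>e\<in>U. (d(u := z)) e \<noteq> 0" using d(2) V(2,3) by fastforce
    moreover have "\<forall>e. e \<notin> U \<longrightarrow> (d(u := z)) e = 0" using d(1) V(3) by auto
    ultimately show ?thesis by blast
  qed
qed

text \<open>Distinct integers are at least 1 apart, and positivity makes the sums distinct. This
  charges one unit of weight for each step of a chain.\<close>

lemma integral_sum_psubset:
  fixes x :: "'e \<Rightarrow> real"
  assumes "finite M" "N \<subset> M" "\<forall>e\<in>M. 0 < x e" "sum x M \<in> \<int>" "sum x N \<in> \<int>"
  shows "sum x N + 1 \<le> sum x M"
proof -
  obtain a b where ab: "sum x M = of_int a" "sum x N = of_int b" using assms(4,5) by (auto elim!: Ints_cases)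
  obtain e where "e \<in> M - N" using assms(2) by blast
  then have "sum x N < sum x M"
    using assms by (intro sum_strict_mono2[where b = e]) (auto intro: less_imp_le)
  then show ?thesis using ab by simp
qed

text \<open>Take the top \<open>M\<close> of the ring and a maximal member \<open>N\<close> among
  the others; the members below \<open>N\<close> form a smaller ring with top \<open>N\<close>. Any
  \<open>A\<close> not below \<open>N\<close> satisfies \<open>A \<union> N = M\<close> by
  maximality, so \<open>d(A) = d(M) + d(A \<inter> N) - d(N)\<close> is determined by
  \<open>M\<close> and sets below \<open>N\<close>. Adding \<open>M\<close> costs one set and gains
  at least one unit of weight. \<open>C\<close> is a chain by construction, but only its size and
  its span are recorded.\<close>

lemma set_ring_chain_spanning:
  fixes x :: "'e \<Rightarrow> real"
  assumes "finite R" "finite (\<Union>R)" "\<forall>e\<in>\<Union>R. 0 < x e" "\<forall>A\<in>R. sum x A \<in> \<int>"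
    and "\<forall>A\<in>R. \<forall>B\<in>R. A \<union> B \<in> R \<and> A \<inter> B \<in> R"
  shows "\<exists>C\<subseteq>R. real (card C) \<le> sum x (\<Union>R) \<and>
    (\<forall>d :: 'e \<Rightarrow> real. (\<forall>A\<in>C. sum d A = 0) \<longrightarrow> (\<forall>A\<in>R. sum d A = 0))"
  using assms
proof (induction R rule: finite_psubset_induct)
  case (psubset R)
  show ?case
  proof (cases "R \<subseteq> {{}}")
    case True
    \<comment> \<open>The empty set is a trivial equation of weight 0, so it must not enter
      \<open>C\<close>.\<close>
    then have "\<Union>R = {}" and "\<And>A. A \<in> R \<Longrightarrow> A = {}" by auto
    then show ?thesis by (metis card.empty empty_subsetI of_nat_0 order_refl sum.empty)
  next
    case False
    then have R: "R \<noteq> {}" by auto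
    define M where "M = \<Union>R"
    have M: "M \<in> R" unfolding M_def using psubset.hyps R psubset.prems(4)
      by (intro finite_Sup_in) auto
    show ?thesis
    proof (cases "R = {M}")
      case True
      have "M \<noteq> {}" using False True by auto
      then have "sum x {} + 1 \<le> sum x M"
        using psubset.prems M by (intro integral_sum_psubset) (auto simp: M_def)
      then have "real (card {M}) \<le> sum x (\<Union>R)" unfolding M_def[symmetric] by simp
      then show ?thesis by (rule_tac exI[of _ R]) (use True in auto)
    next
      case False
      then have "R - {M} \<noteq> {}" using M by auto
      then obtain N where N: "N \<in> R - {M}" "\<And>A. A \<in> R - {M} \<Longrightarrow> N \<subseteq> A \<Longrightarrow> N = A"
        using finite_has_maximal[of "R - {M}"] psubset.hyps by auto
      then have NM: "N \<subset> M" by (auto simp: M_def)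
      define R' where "R' = {A \<in> R. A \<subseteq> N}"
      have R': "R' \<subset> R" "\<Union>R' = N" "\<Union>R' \<subseteq> \<Union>R" using M N NM by (auto simp: R'_def)
      have "\<exists>C\<subseteq>R'. real (card C) \<le> sum x (\<Union>R') \<and>
        (\<forall>d :: 'e \<Rightarrow> real. (\<forall>A\<in>C. sum d A = 0) \<longrightarrow> (\<forall>A\<in>R'. sum d A = 0))"
      proof (rule psubset.IH)
        show "R' \<subset> R" by fact
        show "finite (\<Union>R')" by (rule finite_subset[OF R'(3) psubset.prems(1)])
        show "\<forall>e\<in>\<Union>R'. 0 < x e" using R'(3) psubset.prems(2) by blast
        show "\<forall>A\<in>R'. sum x A \<in> \<int>" using R'(1) psubset.prems(3) by blast
        show "\<forall>A\<in>R'. \<forall>B\<in>R'. A \<union> B \<in> R' \<and> A \<inter> B \<in> R'"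
          using psubset.prems(4) by (auto simp: R'_def)
      qed
      then obtain C where C: "C \<subseteq> R'" "real (card C) \<le> sum x N"
        "\<And>d A. (\<forall>A\<in>C. sum d A = (0::real)) \<Longrightarrow> A \<in> R' \<Longrightarrow> sum d A = 0"
        using R' by metis
      have "sum x N + 1 \<le> sum x M"
        using psubset.prems M N NM by (intro integral_sum_psubset) (auto simp: M_def)
      moreover have "card (insert M C) \<le> card C + 1"
        by (simp add: card_insert_le_m1 card_insert_if)
      ultimately have "real (card (insert M C)) \<le> sum x M" using C(2) by linarith
      moreover have "sum d A = 0" if d: "\<forall>A\<in>insert M C. sum d A = 0" and A: "A \<in> R" for d :: "'e \<Rightarrow> real" and A
      proof (cases "A \<subseteq> N")
        case True
        then show ?thesis using C(3)[of d A] d A by (auto simp: R'_def)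
      next
        case False
        have fin: "finite A" "finite N" using A N psubset.prems(1) by (auto intro: finite_subset)
        have "A \<union> N \<in> R" using A N psubset.prems(4) by auto
        then have "A \<union> N = M" using N(2)[of "A \<union> N"] False by auto
        then have "sum d (A \<union> N) = 0" using d by auto
        moreover have "sum d N = 0" "sum d (A \<inter> N) = 0"
          using C(3)[of d] d A N psubset.prems(4) by (auto simp: R'_def)
        ultimately show ?thesis using sum_Un[OF fin, of d] by auto
      qed
      moreover have "insert M C \<subseteq> R" using C(1) R'(1) M by auto
      ultimately show ?thesis unfolding M_def by blast
    qed
  qed
qed

text \<open>
  The index set \<open>T\<close> has at most \<open>|U| - |C|\<close> elements, where \<open>C\<close> is a spanning chain of \<open>R\<close>. If it has
  fewer, a dimension count suffices. Equality forces every element of \<open>U\<close> into the top of the chain and into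
  exactly \<open>K\<close> degree sets, which makes one of the equations redundant.
\<close>
lemma exists_direction:
  fixes x :: "'e \<Rightarrow> real" and F :: "'i \<Rightarrow> 'e set" and K :: nat
  assumes U: "finite U" "U \<noteq> {}" "\<forall>e\<in>U. 0 < x e \<and> x e < 1"
    and R: "\<Union>R \<subseteq> U" "\<forall>A\<in>R. sum x A \<in> \<int>" "\<forall>A\<in>R. \<forall>B\<in>R. A \<union> B \<in> R \<and> A \<inter> B \<in> R"
    and T: "finite T" "\<forall>i\<in>T. F i \<subseteq> U" "\<forall>i\<in>T. real K \<le> (\<Sum>e\<in>F i. 1 - x e)"
    and K: "0 < K" "\<forall>e\<in>U. card {i \<in> T. e \<in> F i} \<le> K"
  shows "\<exists>d :: 'e \<Rightarrow> real. (\<forall>e. e \<notin> U \<longrightarrow> d e = 0) \<and> (\<exists>e\<in>U. d e \<noteq> 0) \<and>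
    (\<forall>A\<in>R. sum d A = 0) \<and> (\<forall>i\<in>T. sum d (F i) = 0)"
proof -
  have "finite R" using R(1) U(1) by (meson finite_Pow_iff finite_subset Sup_le_iff PowI subsetI)
  moreover have "\<forall>e\<in>\<Union>R. 0 < x e" using R(1) U(3) by blast
  ultimately have "\<exists>C\<subseteq>R. real (card C) \<le> sum x (\<Union>R) \<and>
    (\<forall>d :: 'e \<Rightarrow> real. (\<forall>A\<in>C. sum d A = 0) \<longrightarrow> (\<forall>A\<in>R. sum d A = 0))"
    using R finite_subset[OF R(1) U(1)] by (intro set_ring_chain_spanning)
  then obtain C where C: "C \<subseteq> R" "real (card C) \<le> sum x (\<Union>R)"
    "\<And>d A. (\<forall>A\<in>C. sum d A = (0::real)) \<Longrightarrow> A \<in> R \<Longrightarrow> sum d A = 0"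
    by blast
  have "finite C" using C(1) \<open>finite R\<close> finite_subset by blast
  define deg where "deg e = real (card {i \<in> T. e \<in> F i})" for e
  \<comment> \<open>Double counting of pairs of an element and a degree set containing it.\<close>
  have swap: "(\<Sum>i\<in>T. sum f (F i)) = (\<Sum>e\<in>U. deg e * f e)" for f :: "'e \<Rightarrow> real"
  proof -
    have "(\<Sum>i\<in>T. sum f (F i)) = (\<Sum>i\<in>T. \<Sum>e\<in>U. if e \<in> F i then f e else 0)"
    proof (rule sum.cong[OF refl])
      fix i assume "i \<in> T"
      then have "U \<inter> F i = F i" using T(2) by auto
      then show "sum f (F i) = (\<Sum>e\<in>U. if e \<in> F i then f e else 0)"
        using sum.inter_restrict[OF U(1), of f "F i"] by simp
    qed
    also have "\<dots> = (\<Sum>e\<in>U. \<Sum>i\<in>T. if e \<in> F i then f e else 0)" by (rule sum.swap)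
    also have "\<dots> = (\<Sum>e\<in>U. deg e * f e)"
      using T(1) by (intro sum.cong refl) (simp add: sum.If_cases deg_def Int_def)
    finally show ?thesis .
  qed
  have degK: "deg e \<le> K" if "e \<in> U" for e using K that by (simp add: deg_def)
  have "card T * real K \<le> (\<Sum>i\<in>T. \<Sum>e\<in>F i. 1 - x e)"
    using T(3) by (intro sum_bounded_below) auto
  also have "\<dots> = (\<Sum>e\<in>U. deg e * (1 - x e))" by (rule swap)
  finally have TK: "card T * real K \<le> (\<Sum>e\<in>U. deg e * (1 - x e))" .
  have le: "(\<Sum>e\<in>U. deg e * (1 - x e)) \<le> (\<Sum>e\<in>U. K * (1 - x e))"
    using degK U(3) by (intro sum_mono mult_right_mono) auto
  have KU: "(\<Sum>e\<in>U. K * (1 - x e)) = K * (card U - sum x U)"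
    by (simp add: sum_distrib_left[symmetric] sum_subtractf)
  have "card T * real K \<le> K * (card U - sum x U)" using TK le KU by linarith
  then have TU: "card T \<le> card U - sum x U" using K(1) by (simp add: mult.commute)
  have RU: "sum x (\<Union>R) \<le> sum x U" using U R by (intro sum_mono2) (auto intro: less_imp_le)
  have solve: "\<exists>d :: 'e \<Rightarrow> real. (\<forall>e. e \<notin> U \<longrightarrow> d e = 0) \<and> (\<exists>e\<in>U. d e \<noteq> 0) \<and>
      (\<forall>A\<in>R. sum d A = 0) \<and> (\<forall>i\<in>T'. sum d (F i) = 0)"
    if T': "T' \<subseteq> T" "card C + card T' < card U" for T'
  proof -
    have "finite T'" using T'(1) T(1) finite_subset by blast
    then have "card (C \<union> F ` T') < card U"
      using card_Un_le[of C "F ` T'"] card_image_le[of T' F] T'(2) by linarith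
    then obtain d where d: "\<forall>e. e \<notin> U \<longrightarrow> d e = (0::real)" "\<exists>e\<in>U. d e \<noteq> 0"
      "\<forall>A\<in>C \<union> F ` T'. (\<Sum>e\<in>U. of_bool (e \<in> A) * d e) = 0"
      using homogeneous_system_nontrivial_solution[of "C \<union> F ` T'" U "\<lambda>A e. of_bool (e \<in> A)"]
        \<open>finite C\<close> \<open>finite T'\<close> U(1) by blast
    have ind: "sum d A = (\<Sum>e\<in>U. of_bool (e \<in> A) * d e)" if "A \<subseteq> U" for A
    proof -
      have "U \<inter> A = A" using that by auto
      then have "sum d A = (\<Sum>e\<in>U. if e \<in> A then d e else 0)"
        using sum.inter_restrict[OF U(1), of d A] by simp
      then show ?thesis by (auto intro!: sum.cong)
    qed
    have *: "sum d A = 0" if "A \<in> C \<union> F ` T'" for A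
    proof -
      have "A \<subseteq> U" using that C(1) R(1) T(2) T'(1) by blast
      then show ?thesis using ind d(3) that by simp
    qed
    then have "\<forall>A\<in>R. sum d A = 0" using C(3)[of d] by blast
    with d * show ?thesis by (intro exI[of _ d]) auto
  qed
  show ?thesis
  proof (cases "card C + card T < card U")
    case True
    then show ?thesis using solve[of T] by blast
  next
    case False
    have eq: "sum x (\<Union>R) = sum x U" "card T = card U - sum x U" "card C + card T = card U"
      using False TU C(2) RU by linarith+
    have UR: "\<Union>R = U"
    proof (rule ccontr)
      assume "\<Union>R \<noteq> U"
      then obtain e where "e \<in> U - \<Union>R" using R(1) by blast
      then have "sum x (\<Union>R) < sum x U"
        using U R by (intro sum_strict_mono2[where b = e]) (auto intro: less_imp_le)
      then show False using eq by simp
    qed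
    \<comment> \<open>Termwise \<open>deg e \<le> K\<close>, yet the weighted sums agree, so every
      term is an equality; \<open>x e < 1\<close> then cancels the factor
      \<open>1 - x e\<close>.\<close>
    have "sum (\<lambda>e. K * (1 - x e) - deg e * (1 - x e)) U = 0"
      using TK le KU eq by (simp add: sum_subtractf mult.commute)
    then have "\<forall>e\<in>U. K * (1 - x e) - deg e * (1 - x e) = 0"
      using degK U by (subst (asm) sum_nonneg_eq_0_iff) (auto intro!: mult_right_mono)
    then have degeq: "deg e = K" if "e \<in> U" for e using U(3) that by fastforce
    \<comment> \<open>All values on \<open>U\<close> are below 1, so
      \<open>card T = card U - sum x U\<close> is positive and there is an equation to leave
      out.\<close>
    have "sum x U < (\<Sum>e\<in>U. 1)" using U by (intro sum_strict_mono) auto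
    then have "T \<noteq> {}" using eq C(2) by auto
    then obtain k where k: "k \<in> T" by blast
    have "card C + card (T - {k}) < card U" using eq(3) card_Diff1_less[OF T(1) k] by linarith
    then obtain d where d: "\<forall>e. e \<notin> U \<longrightarrow> d e = 0" "\<exists>e\<in>U. d e \<noteq> 0"
      "\<forall>A\<in>R. sum d A = 0" "\<forall>i\<in>T - {k}. sum d (F i) = (0::real)" using solve[of "T - {k}"] by blast
    have "R \<noteq> {}" using UR U(2) by auto
    then have "U \<in> R" using UR \<open>finite R\<close> R(3)
      by (metis finite_Sup_in sup_set_def)
    \<comment> \<open>Summing over \<open>T\<close> counts each element of \<open>U\<close> exactly
      \<open>K\<close> times, and \<open>d(U) = 0\<close> because \<open>U\<close> is itself a
      member of the ring. So the omitted equation for \<open>k\<close> follows from the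
      others.\<close>
    have "(\<Sum>i\<in>T. sum d (F i)) = (\<Sum>e\<in>U. K * d e)" unfolding swap using degeq by simp
    also have "\<dots> = 0" using d(3) \<open>U \<in> R\<close> by (simp add: sum_distrib_left[symmetric])
    finally have "sum d (F k) = 0" using d(4) k T(1) by (simp add: sum.remove)
    then show ?thesis using d by (intro exI[of _ d]) auto
  qed
qed

text \<open>The minimum ratio rule of the simplex method. Entries with \<open>a q = 0\<close> have
  slope 0 and cannot block, so the entry that reaches 0 first was positive before: this is the
  progress of a move.\<close>

lemma ratio_test:
  fixes a b :: "'q \<Rightarrow> real"
  assumes "finite Q" "\<forall>q\<in>Q. 0 \<le> a q" "\<forall>q\<in>Q. a q = 0 \<longrightarrow> b q = 0" "\<exists>q\<in>Q. b q < 0"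
  shows "\<exists>t\<ge>0. (\<forall>q\<in>Q. 0 \<le> a q + t * b q) \<and> (\<exists>q\<in>Q. a q \<noteq> 0 \<and> a q + t * b q = 0)"
proof -
  define N where "N = {q \<in> Q. b q < 0}"
  have N: "finite N" "N \<noteq> {}" using assms by (auto simp: N_def)
  define t where "t = Min ((\<lambda>q. a q / - b q) ` N)"
  have "t \<in> (\<lambda>q. a q / - b q) ` N" unfolding t_def using N by (intro Min_in) auto
  then obtain q where q: "q \<in> N" "t = a q / - b q" by blast
  have le: "t \<le> a p / - b p" if "p \<in> N" for p unfolding t_def using N that by (intro Min_le) auto
  have "0 \<le> t" using q assms(2) by (auto simp: N_def divide_nonneg_nonpos)
  have "0 \<le> a p + t * b p" if "p \<in> Q" for p
  proof (cases "b p < 0")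
    case True
    then show ?thesis using le[of p] that by (auto simp: N_def field_simps)
  next
    case False
    then show ?thesis using \<open>0 \<le> t\<close> assms(2) that by simp
  qed
  moreover have "a q + t * b q = 0" "a q \<noteq> 0" "q \<in> Q" using q assms(3) by (auto simp: N_def)
  ultimately show ?thesis using \<open>0 \<le> t\<close> by blast
qed

section \<open>Tight constraints and free directions\<close>

text \<open>Uncrossing: \<open>r(S) + r(T)\<close> is at most the rank sum of meet and join, which
  is at most their \<open>x\<close>-weight, which is at most
  \<open>x(\<rho>(S)) + x(\<rho>(T))\<close>. Tightness of \<open>S\<close> and \<open>T\<close>
  closes this circle, so all are equalities. The inclusion order makes the join exactly the union,
  but gives only one inclusion for the meet; the elements it misses have \<open>x\<close>-value 0,
  hence the restriction to positive coordinates.\<close>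

lemma tight_sets_union_inter:
  assumes L: "clp_instance L" "clp_inclusion_ordered L"
    and x: "x \<in> clp_ground L \<rightarrow> {0..1}" "clp_rank_ok L x"
    and S: "S \<in> clp_family L" "sum x (clp_rho L S) = clp_rank L S"
    and T: "T \<in> clp_family L" "sum x (clp_rho L T) = clp_rank L T"
  shows "\<exists>V\<in>clp_family L. sum x (clp_rho L V) = clp_rank L V \<and> clp_rho L V = clp_rho L S \<union> clp_rho L T"
    and "\<exists>W\<in>clp_family L. sum x (clp_rho L W) = clp_rank L W \<and>
      {e \<in> clp_rho L W. 0 < x e} = {e \<in> clp_rho L S \<inter> clp_rho L T. 0 < x e}"
proof -
  let ?V = "clp_join L S T" and ?W = "clp_meet L S T" and ?\<rho> = "clp_rho L"
  have VW: "?V \<in> clp_family L" "?W \<in> clp_family L"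
    using L(1) S T by (simp_all add: clp_instance_def clp_lattice_def)
  have "clp_le L ?W S" "clp_le L ?W T" "clp_le L S ?V" "clp_le L T ?V"
    using L(1) S T by (simp_all add: clp_instance_def clp_lattice_def)
  then have incl: "?\<rho> ?W \<subseteq> ?\<rho> S \<inter> ?\<rho> T" "?\<rho> S \<union> ?\<rho> T \<subseteq> ?\<rho> ?V"
    using L(2) S T VW by (auto simp: clp_inclusion_ordered_def)
  moreover have "?\<rho> ?V \<union> ?\<rho> ?W \<subseteq> ?\<rho> S \<union> ?\<rho> T"
    using L(1) S T by (simp add: clp_instance_def clp_submodular_def)
  ultimately have V: "?\<rho> ?V = ?\<rho> S \<union> ?\<rho> T" by auto
  have ground: "?\<rho> S \<subseteq> clp_ground L" "?\<rho> T \<subseteq> clp_ground L" and "finite (clp_ground L)"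
    using L(1) S T by (simp_all add: clp_instance_def)
  then have fin: "finite (?\<rho> S)" "finite (?\<rho> T)" by (auto intro: finite_subset)
  have nonneg: "0 \<le> x e" if "e \<in> ?\<rho> S" for e using ground x that by auto
  have "clp_rank L S + clp_rank L T \<le> clp_rank L ?W + clp_rank L ?V"
    using L(1) S T by (simp add: clp_instance_def clp_supermodular_def)
  then have "real (clp_rank L S) + clp_rank L T \<le> real (clp_rank L ?W) + clp_rank L ?V" by linarith
  moreover have "clp_rank L ?W \<le> sum x (?\<rho> ?W)" "clp_rank L ?V \<le> sum x (?\<rho> ?V)"
    using x VW by (auto simp: clp_rank_ok_def)
  moreover have "sum x (?\<rho> S) + sum x (?\<rho> T) = sum x (?\<rho> ?V) + sum x (?\<rho> S \<inter> ?\<rho> T)"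
    unfolding V using fin by (rule sum.union_inter[symmetric])
  moreover have "sum x (?\<rho> ?W) \<le> sum x (?\<rho> S \<inter> ?\<rho> T)"
    using incl fin nonneg by (intro sum_mono2) auto
  ultimately have eq: "sum x (?\<rho> ?V) = clp_rank L ?V" "sum x (?\<rho> ?W) = clp_rank L ?W"
    "sum x (?\<rho> S \<inter> ?\<rho> T) = sum x (?\<rho> ?W)"
    using S(2) T(2) by linarith+
  show "\<exists>V\<in>clp_family L. sum x (clp_rho L V) = clp_rank L V \<and> clp_rho L V = clp_rho L S \<union> clp_rho L T"
    using VW eq V by blast
  have "e \<in> ?\<rho> ?W" if e: "e \<in> ?\<rho> S \<inter> ?\<rho> T" "0 < x e" for e
  proof (rule ccontr)
    assume "e \<notin> ?\<rho> ?W"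
    then have "sum x (?\<rho> ?W) < sum x (?\<rho> S \<inter> ?\<rho> T)"
      using e incl fin nonneg by (intro sum_strict_mono2[where b = e]) auto
    then show False using eq by simp
  qed
  then have "{e \<in> ?\<rho> ?W. 0 < x e} = {e \<in> ?\<rho> S \<inter> ?\<rho> T. 0 < x e}" using incl by blast
  then show "\<exists>W\<in>clp_family L. sum x (clp_rho L W) = clp_rank L W \<and>
      {e \<in> clp_rho L W. 0 < x e} = {e \<in> clp_rho L S \<inter> clp_rho L T. 0 < x e}"
    using VW eq by blast
qed

text \<open>All sets are cut down to the fractional coordinates \<open>U\<close>. Coordinates at 0
  or 1 contribute integers, so tight rank sets keep integral weight. In a tight degree set an
  element of value 1 counts once in the support and once in the bound and cancels, so the surplus
  \<open>K\<close> is carried by \<open>1 - x e\<close> on \<open>U\<close> alone.\<close>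

lemma tight_direction:
  fixes L :: "('f, 'e, 'i) clp" and K :: nat
  assumes L: "clp_instance L" "clp_inclusion_ordered L"
    and x: "x \<in> clp_ground L \<rightarrow> {0..1}" "clp_rank_ok L x"
    and U: "U = {e \<in> clp_ground L. 0 < x e \<and> x e < 1}" "U \<noteq> {}"
    and J: "J \<subseteq> clp_index L"
      "\<forall>i\<in>J. of_int (clp_bound L i) + real K \<le> real (card {e \<in> clp_deg_set L i. 0 < x e})"
    and K: "0 < K" "\<forall>e\<in>clp_ground L. card {i \<in> clp_index L. e \<in> clp_deg_set L i} \<le> K"
  shows "\<exists>d :: 'e \<Rightarrow> real. (\<forall>e. e \<notin> U \<longrightarrow> d e = 0) \<and> (\<exists>e\<in>U. d e \<noteq> 0) \<and>
    (\<forall>S\<in>clp_family L. sum x (clp_rho L S) = clp_rank L S \<longrightarrow> sum d (clp_rho L S) = 0) \<and>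
    (\<forall>i\<in>J. sum x (clp_deg_set L i) = clp_bound L i \<longrightarrow> sum d (clp_deg_set L i) = 0)"
proof -
  define tight where "tight = {S \<in> clp_family L. sum x (clp_rho L S) = clp_rank L S}"
  define T where "T = {i \<in> J. sum x (clp_deg_set L i) = clp_bound L i}"
  define R where "R = (\<lambda>S. clp_rho L S \<inter> U) ` tight"
  have fin: "finite (clp_ground L)" "finite (clp_index L)" using L by (simp_all add: clp_instance_def)
  have rho: "clp_rho L S \<subseteq> clp_ground L" if "S \<in> clp_family L" for S
    using L that by (simp add: clp_instance_def)
  have deg: "clp_deg_set L i \<subseteq> clp_ground L" if "i \<in> J" for i
    using L J that by (auto simp: clp_instance_def)
  have x01: "x e = 0 \<or> x e = 1" if "e \<in> clp_ground L - U" for e using that x(1) U(1) by force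
  have "\<exists>d :: 'e \<Rightarrow> real. (\<forall>e. e \<notin> U \<longrightarrow> d e = 0) \<and> (\<exists>e\<in>U. d e \<noteq> 0) \<and>
    (\<forall>A\<in>R. sum d A = 0) \<and> (\<forall>i\<in>T. sum d (clp_deg_set L i \<inter> U) = 0)"
  proof (rule exists_direction)
    show "finite U" using fin U(1) by simp
    show "U \<noteq> {}" by fact
    show "\<forall>e\<in>U. 0 < x e \<and> x e < 1" using U(1) by simp
    show "\<Union>R \<subseteq> U" by (auto simp: R_def)
    show "\<forall>A\<in>R. sum x A \<in> \<int>"
    proof
      fix A assume "A \<in> R"
      then obtain S where S: "S \<in> tight" "A = clp_rho L S \<inter> U" by (auto simp: R_def)
      then have sub: "clp_rho L S \<subseteq> clp_ground L" using rho by (simp add: tight_def)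
      then have "sum x (clp_rho L S) = sum x (clp_rho L S \<inter> U) + sum x (clp_rho L S - U)"
        using fin(1) by (intro sum.Int_Diff) (auto intro: finite_subset)
      moreover have "sum x (clp_rho L S - U) \<in> \<int>" using x01 sub by (intro Ints_sum) force
      moreover have "sum x (clp_rho L S) \<in> \<int>" using S by (simp add: tight_def)
      ultimately show "sum x A \<in> \<int>" using S(2) Ints_diff by (metis add_diff_cancel_right')
    qed
    show "\<forall>A\<in>R. \<forall>B\<in>R. A \<union> B \<in> R \<and> A \<inter> B \<in> R"
    proof (intro ballI)
      fix A B assume "A \<in> R" "B \<in> R"
      then obtain S S' where S: "S \<in> tight" "A = clp_rho L S \<inter> U" "S' \<in> tight" "B = clp_rho L S' \<inter> U"
        by (auto simp: R_def)
      obtain V where "V \<in> tight" "clp_rho L V = clp_rho L S \<union> clp_rho L S'"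
        using tight_sets_union_inter(1)[OF L x, of S S'] S by (auto simp: tight_def)
      then have "A \<union> B \<in> R" unfolding R_def using S by (intro image_eqI[of _ _ V]) auto
      moreover obtain W where W: "W \<in> tight"
        "{e \<in> clp_rho L W. 0 < x e} = {e \<in> clp_rho L S \<inter> clp_rho L S'. 0 < x e}"
        using tight_sets_union_inter(2)[OF L x, of S S'] S by (auto simp: tight_def)
      \<comment> \<open>\<open>U\<close> lies in the positive support, where
        \<open>\<rho>(W)\<close> and the intersection agree.\<close>
      have "A \<inter> B = clp_rho L W \<inter> U" using W(2) S(2,4) U(1) by blast
      then have "A \<inter> B \<in> R" unfolding R_def using W(1) by blast
      ultimately show "A \<union> B \<in> R \<and> A \<inter> B \<in> R" ..
    qed
    show "finite T" using J(1) fin(2) by (auto simp: T_def intro: finite_subset)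
    show "\<forall>i\<in>T. clp_deg_set L i \<inter> U \<subseteq> U" by simp
    show "\<forall>i\<in>T. real K \<le> (\<Sum>e\<in>clp_deg_set L i \<inter> U. 1 - x e)"
    proof
      fix i assume i: "i \<in> T"
      then have sub: "clp_deg_set L i \<subseteq> clp_ground L" using deg by (simp add: T_def)
      then have fin_i: "finite (clp_deg_set L i)" using fin finite_subset by blast
      have "real K \<le> real (card {e \<in> clp_deg_set L i. 0 < x e}) - sum x (clp_deg_set L i)"
        using i J(2) by (auto simp: T_def)
      also have "\<dots> = (\<Sum>e\<in>clp_deg_set L i. of_bool (0 < x e) - x e)"
        using fin_i by (simp add: sum_subtractf sum.If_cases of_bool_def Int_def)
      also have "\<dots> = (\<Sum>e\<in>clp_deg_set L i. if e \<in> U then 1 - x e else 0)"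
      proof (rule sum.cong[OF refl])
        fix e assume "e \<in> clp_deg_set L i"
        then show "of_bool (0 < x e) - x e = (if e \<in> U then 1 - x e else 0)"
          using x01[of e] sub U(1) by auto
      qed
      also have "\<dots> = (\<Sum>e\<in>clp_deg_set L i \<inter> U. 1 - x e)"
        using fin_i by (simp add: sum.inter_restrict)
      finally show "real K \<le> (\<Sum>e\<in>clp_deg_set L i \<inter> U. 1 - x e)" .
    qed
    show "0 < K" by fact
    show "\<forall>e\<in>U. card {i \<in> T. e \<in> clp_deg_set L i \<inter> U} \<le> K"
    proof
      fix e assume "e \<in> U"
      then have "card {i \<in> clp_index L. e \<in> clp_deg_set L i} \<le> K" using K U(1) by simp
      moreover have "card {i \<in> T. e \<in> clp_deg_set L i \<inter> U} \<le> card {i \<in> clp_index L. e \<in> clp_deg_set L i}"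
        using fin(2) J(1) by (intro card_mono) (auto simp: T_def)
      ultimately show "card {i \<in> T. e \<in> clp_deg_set L i \<inter> U} \<le> K" by linarith
    qed
  qed
  then obtain d :: "'e \<Rightarrow> real" where d: "\<forall>e. e \<notin> U \<longrightarrow> d e = 0" "\<exists>e\<in>U. d e \<noteq> 0"
    "\<forall>A\<in>R. sum d A = 0" "\<forall>i\<in>T. sum d (clp_deg_set L i \<inter> U) = 0" by blast
  have restr: "sum d A = sum d (A \<inter> U)" if "A \<subseteq> clp_ground L" for A
    using that fin(1) d(1) by (intro sum.mono_neutral_right) (auto intro: finite_subset)
  have "sum d (clp_rho L S) = 0" if "S \<in> clp_family L" "sum x (clp_rho L S) = clp_rank L S" for S
    using that restr[OF rho] d(3) by (auto simp: R_def tight_def)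
  moreover have "sum d (clp_deg_set L i) = 0" if "i \<in> J" "sum x (clp_deg_set L i) = clp_bound L i" for i
    using that restr[OF deg] d(4) by (auto simp: T_def)
  ultimately show ?thesis using d(1,2) by blast
qed

section \<open>Slacks and the rounding induction\<close>

text \<open>Box, rank and degree constraints all become functions that are nonnegative exactly on
  feasible points. This lets one ratio test treat them uniformly, and the number of nonzero slacks
  serves as an induction measure.\<close>

definition clp_slacks :: "('f, 'e, 'i) clp \<Rightarrow> 'i set \<Rightarrow> (('e \<Rightarrow> real) \<Rightarrow> real) set" where
  "clp_slacks L J =
     (\<lambda>e x. x e) ` clp_ground L \<union> (\<lambda>e x. 1 - x e) ` clp_ground L \<union>
     (\<lambda>S x. sum x (clp_rho L S) - real (clp_rank L S)) ` clp_family L \<union>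
     (\<lambda>i x. of_int (clp_bound L i) - sum x (clp_deg_set L i)) ` J"

lemma clp_slacks_nonneg_iff:
  "(\<forall>q\<in>clp_slacks L J. 0 \<le> q x) \<longleftrightarrow>
     x \<in> clp_ground L \<rightarrow> {0..1} \<and> clp_rank_ok L x \<and>
     (\<forall>i\<in>J. sum x (clp_deg_set L i) \<le> of_int (clp_bound L i))"
  unfolding clp_slacks_def clp_rank_ok_def by (auto simp: ball_Un Pi_iff)

text \<open>Slacks are affine, so the slope along a line can be read off at
  \<open>t = 1\<close>.\<close>

lemma clp_slacks_affine:
  assumes "q \<in> clp_slacks L J"
  shows "q (\<lambda>e. x e + t * d e) = q x + t * (q (\<lambda>e. x e + d e) - q x)"
  using assms unfolding clp_slacks_def
  by (auto simp: sum.distrib sum_distrib_left[symmetric] algebra_simps)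

text \<open>
  Iterative relaxation without extreme points: from a fractional \<open>x\<close>, either some degree constraint
  can be dropped for good, or one can move along a line that keeps all tight constraints tight until
  a further constraint becomes tight.
\<close>
lemma iterative_relaxation:
  fixes L :: "('f, 'e, 'i) clp" and K :: nat
  assumes L: "clp_instance L" "clp_inclusion_ordered L"
    and K: "0 < K" "\<forall>e\<in>clp_ground L. card {i \<in> clp_index L. e \<in> clp_deg_set L i} \<le> K"
    and "J \<subseteq> clp_index L" "x \<in> clp_ground L \<rightarrow> {0..1}" "clp_rank_ok L x"
      "\<forall>i\<in>J. sum x (clp_deg_set L i) \<le> of_int (clp_bound L i)"
  shows "\<exists>y\<in>clp_ground L \<rightarrow> {0, 1}. clp_rank_ok L y \<and> clp_cost L y \<le> clp_cost L x \<and>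
    (\<forall>i\<in>J. sum y (clp_deg_set L i) \<le> of_int (clp_bound L i) + (real K - 1)) \<and>
    (\<forall>e\<in>clp_ground L. x e = 0 \<longrightarrow> y e = 0)"
  using assms(5-)
\<comment> \<open>Dropping a constraint lowers \<open>card J\<close> and cannot create nonzero
  slacks; a move keeps \<open>J\<close> and makes one more slack vanish.\<close>
proof (induction "card {q \<in> clp_slacks L J. q x \<noteq> 0} + card J" arbitrary: x J rule: less_induct)
  case less
  have fin: "finite (clp_ground L)" "finite (clp_index L)" "finite (clp_family L)"
    using L clp_finite_family by (auto simp: clp_instance_def)
  have finJ: "finite J" using less.prems fin finite_subset by blast
  have fins: "finite (clp_slacks L J)" using fin finJ by (simp add: clp_slacks_def)
  define U where "U = {e \<in> clp_ground L. 0 < x e \<and> x e < 1}"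
  consider (int) "U = {}"
    | (drop) i where "i \<in> J" "real (card {e \<in> clp_deg_set L i. 0 < x e}) < of_int (clp_bound L i) + real K"
    | (move) "U \<noteq> {}" "\<forall>i\<in>J. of_int (clp_bound L i) + real K \<le> real (card {e \<in> clp_deg_set L i. 0 < x e})"
    by force
  then show ?case
  proof cases
    case int
    then have "x \<in> clp_ground L \<rightarrow> {0, 1}" using less.prems(2) by (force simp: U_def)
    then show ?thesis using less.prems K(1) by (intro bexI[of _ x]) fastforce+
  next
    case drop
    have sub: "clp_slacks L (J - {i}) \<subseteq> clp_slacks L J" by (auto simp: clp_slacks_def)
    have "card {q \<in> clp_slacks L (J - {i}). q x \<noteq> 0} \<le> card {q \<in> clp_slacks L J. q x \<noteq> 0}"
      using fins sub by (intro card_mono) auto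
    moreover have "card (J - {i}) < card J" using drop finJ by (intro card_Diff1_less)
    ultimately obtain y where y: "y \<in> clp_ground L \<rightarrow> {0, 1}" "clp_rank_ok L y" "clp_cost L y \<le> clp_cost L x"
      "\<forall>i\<in>J - {i}. sum y (clp_deg_set L i) \<le> of_int (clp_bound L i) + (real K - 1)"
      "\<forall>e\<in>clp_ground L. x e = 0 \<longrightarrow> y e = 0"
      using less.hyps[of "J - {i}" x] less.prems by fastforce
    have sub_i: "clp_deg_set L i \<subseteq> clp_ground L"
      using L(1) less.prems(1) drop(1) by (auto simp: clp_instance_def)
    \<comment> \<open>The dropped constraint is recovered from the preserved zeros: \<open>y\<close>
      selects only elements with positive \<open>x\<close>-value.\<close>
    have "sum y (clp_deg_set L i) \<le> (\<Sum>e\<in>clp_deg_set L i. of_bool (0 < x e))"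
    proof (rule sum_mono)
      fix e assume "e \<in> clp_deg_set L i"
      then have "e \<in> clp_ground L" using sub_i by blast
      then have "0 \<le> x e" "y e = 0 \<or> y e = 1" "x e = 0 \<longrightarrow> y e = 0"
        using less.prems(2) y by auto
      then show "y e \<le> of_bool (0 < x e)" by auto
    qed
    also have "\<dots> = real (card {e \<in> clp_deg_set L i. 0 < x e})"
      using finite_subset[OF sub_i fin(1)] by (simp add: sum.If_cases of_bool_def Int_def)
    \<comment> \<open>A strict inequality between integers; this is the origin of the
      \<open>- 1\<close>.\<close>
    also have "\<dots> \<le> of_int (clp_bound L i) + (real K - 1)"
    proof -
      have "real_of_int (int (card {e \<in> clp_deg_set L i. 0 < x e})) < real_of_int (clp_bound L i + int K)"
        using drop(2) by simp
      then have "int (card {e \<in> clp_deg_set L i. 0 < x e}) \<le> clp_bound L i + int K - 1"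
        unfolding of_int_less_iff by linarith
      then have "real_of_int (int (card {e \<in> clp_deg_set L i. 0 < x e}))
          \<le> real_of_int (clp_bound L i + int K - 1)"
        unfolding of_int_le_iff .
      then show ?thesis by simp
    qed
    finally show ?thesis using y by (intro bexI[of _ y]) auto
  next
    case move
    obtain d0 where d0: "\<forall>e. e \<notin> U \<longrightarrow> d0 e = (0::real)" "\<exists>e\<in>U. d0 e \<noteq> 0"
      "\<forall>S\<in>clp_family L. sum x (clp_rho L S) = clp_rank L S \<longrightarrow> sum d0 (clp_rho L S) = 0"
      "\<forall>i\<in>J. sum x (clp_deg_set L i) = clp_bound L i \<longrightarrow> sum d0 (clp_deg_set L i) = 0"
      using tight_direction[OF L less.prems(2,3) U_def move(1) less.prems(1) move(2) K] by blast
    \<comment> \<open>The equations are homogeneous, so the sign is free and is chosen such that the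
      cost does not increase.\<close>
    define d where "d = (\<lambda>e. (if clp_cost L d0 \<le> 0 then 1 else - 1) * d0 e)"
    have d: "\<forall>e. e \<notin> U \<longrightarrow> d e = 0" "\<exists>e\<in>U. d e \<noteq> 0"
      "\<forall>S\<in>clp_family L. sum x (clp_rho L S) = clp_rank L S \<longrightarrow> sum d (clp_rho L S) = 0"
      "\<forall>i\<in>J. sum x (clp_deg_set L i) = clp_bound L i \<longrightarrow> sum d (clp_deg_set L i) = 0"
      using d0 by (simp_all add: d_def sum_distrib_left[symmetric] sum_negf)
    have cost_d: "clp_cost L d \<le> 0"
      by (simp add: d_def clp_cost_def sum_negf)
    define \<delta> where "\<delta> q = q (\<lambda>e. x e + d e) - q x" for q :: "('e \<Rightarrow> real) \<Rightarrow> real"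
    have "\<exists>t\<ge>0. (\<forall>q\<in>clp_slacks L J. 0 \<le> q x + t * \<delta> q) \<and>
      (\<exists>q\<in>clp_slacks L J. q x \<noteq> 0 \<and> q x + t * \<delta> q = 0)"
    proof (rule ratio_test)
      show "finite (clp_slacks L J)" by fact
      show "\<forall>q\<in>clp_slacks L J. 0 \<le> q x" unfolding clp_slacks_nonneg_iff using less.prems by blast
      show "\<forall>q\<in>clp_slacks L J. q x = 0 \<longrightarrow> \<delta> q = 0"
        unfolding clp_slacks_def \<delta>_def using d(1,3,4) by (auto simp: sum.distrib U_def)
      \<comment> \<open>The slacks \<open>x e\<close> and \<open>1 - x e\<close> have opposite
        slopes, so one of them decreases and the move is blocked eventually.\<close>
      obtain e where e: "e \<in> U" "d e \<noteq> 0" using d(2) by blast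
      then have "(\<lambda>x. x e) \<in> clp_slacks L J" "(\<lambda>x. 1 - x e) \<in> clp_slacks L J"
        by (auto simp: U_def clp_slacks_def)
      moreover have "\<delta> (\<lambda>x. x e) < 0 \<or> \<delta> (\<lambda>x. 1 - x e) < 0" using e by (auto simp: \<delta>_def)
      ultimately show "\<exists>q\<in>clp_slacks L J. \<delta> q < 0" by blast
    qed
    then obtain t q where t: "0 \<le> t" "\<forall>q\<in>clp_slacks L J. 0 \<le> q x + t * \<delta> q"
      "q \<in> clp_slacks L J" "q x \<noteq> 0" "q x + t * \<delta> q = 0" by blast
    define z where "z = (\<lambda>e. x e + t * d e)"
    have qz: "q z = q x + t * \<delta> q" if "q \<in> clp_slacks L J" for q
      unfolding z_def \<delta>_def using that by (rule clp_slacks_affine)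
    have "\<forall>q\<in>clp_slacks L J. 0 \<le> q z" using t(2) qz by simp
    then have z: "z \<in> clp_ground L \<rightarrow> {0..1}" "clp_rank_ok L z"
      "\<forall>i\<in>J. sum z (clp_deg_set L i) \<le> of_int (clp_bound L i)"
      unfolding clp_slacks_nonneg_iff by blast+
    \<comment> \<open>Vanishing slacks have slope 0 and stay zero, while the blocking slack
      \<open>q\<close> is new among them.\<close>
    have "{q \<in> clp_slacks L J. q z \<noteq> 0} \<subset> {q \<in> clp_slacks L J. q x \<noteq> 0}"
    proof
      show "{q \<in> clp_slacks L J. q z \<noteq> 0} \<subseteq> {q \<in> clp_slacks L J. q x \<noteq> 0}"
        unfolding clp_slacks_def z_def using d(1,3,4)
        by (auto simp: sum.distrib sum_distrib_left[symmetric] U_def)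
      show "{q \<in> clp_slacks L J. q z \<noteq> 0} \<noteq> {q \<in> clp_slacks L J. q x \<noteq> 0}"
        using t(3-5) qz by auto
    qed
    then have "card {q \<in> clp_slacks L J. q z \<noteq> 0} < card {q \<in> clp_slacks L J. q x \<noteq> 0}"
      using fins by (intro psubset_card_mono) auto
    then obtain y where y: "y \<in> clp_ground L \<rightarrow> {0, 1}" "clp_rank_ok L y" "clp_cost L y \<le> clp_cost L z"
      "\<forall>i\<in>J. sum y (clp_deg_set L i) \<le> of_int (clp_bound L i) + (real K - 1)"
      "\<forall>e\<in>clp_ground L. z e = 0 \<longrightarrow> y e = 0"
      using less.hyps[of J z] less.prems(1) z by auto
    have "clp_cost L z = clp_cost L x + t * clp_cost L d"
      by (simp add: clp_cost_def z_def algebra_simps sum.distrib sum_distrib_left)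
    then have "clp_cost L z \<le> clp_cost L x" using t(1) cost_d by (simp add: mult_nonneg_nonpos)
    moreover have "z e = 0" if "x e = 0" for e using that d(1) by (simp add: z_def U_def)
    ultimately show ?thesis using y by (intro bexI[of _ y]) auto
  qed
qed

lemma clp_deg_le_Delta:
  assumes "clp_instance L" "e \<in> clp_ground L"
  shows "card {i \<in> clp_index L. e \<in> clp_deg_set L i} \<le> clp_Delta L"
  using assms unfolding clp_Delta_def clp_instance_def by (intro Max_ge) auto

lemma near_feasible_below_fractional:
  assumes L: "clp_instance L" "clp_inclusion_ordered L" and x: "x \<in> clp_feasible L {0..1}"
  shows "\<exists>y. clp_near_feasible L y \<and> clp_cost L y \<le> clp_cost L x"
proof -
  \<comment> \<open>Rounding needs a positive constant, hence \<open>max 1 (clp_Delta L)\<close>;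
    one less is exactly the truncated slack of \<open>clp_near_feasible\<close>.\<close>
  have "\<exists>y\<in>clp_ground L \<rightarrow> {0, 1}. clp_rank_ok L y \<and> clp_cost L y \<le> clp_cost L x \<and>
    (\<forall>i\<in>clp_index L. sum y (clp_deg_set L i) \<le> of_int (clp_bound L i) + (real (max 1 (clp_Delta L)) - 1)) \<and>
    (\<forall>e\<in>clp_ground L. x e = 0 \<longrightarrow> y e = 0)"
    using x clp_deg_le_Delta[OF L(1)] L(1)
    by (intro iterative_relaxation L) (auto simp: clp_feasible_def clp_instance_def le_max_iff_disj)
  moreover have "real (max 1 (clp_Delta L)) - 1 = max 0 (real (clp_Delta L) - 1)" by auto
  ultimately show ?thesis by (auto simp: clp_near_feasible_def)
qed


section \<open>Total correctness\<close>

text \<open>Termination is part of the claim. Since runs are deterministic, the existence of one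
  good run is the weakest precondition.\<close>

definition wp :: "prog \<Rightarrow> (mem \<Rightarrow> bool) \<Rightarrow> mem \<Rightarrow> bool" where
  "wp p Q s \<longleftrightarrow> (\<exists>t. terminates_in p s t \<and> Q t)"

lemma wp_skip [simp]: "wp PSkip Q s \<longleftrightarrow> Q s"
  unfolding wp_def by (metis skipE terminates_in.skip)

lemma wp_iset [simp]: "wp (PISet v a b) Q s \<longleftrightarrow> Q (iput v (ival a s) (ival b s) s)"
  unfolding wp_def by (metis isetE terminates_in.iset)

lemma wp_rset [simp]: "wp (PRSet v a b) Q s \<longleftrightarrow> Q (rput v (ival a s) (rval b s) s)"
  unfolding wp_def by (metis rsetE terminates_in.rset)

lemma wp_if [simp]: "wp (PIf b p q) Q s \<longleftrightarrow> (if holds b s then wp p Q s else wp q Q s)"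
  unfolding wp_def by (metis ifE terminates_in.if_true terminates_in.if_false)

lemma wp_seqI:
  assumes "wp p R s" "\<And>t. R t \<Longrightarrow> wp q Q t"
  shows "wp (PSeq p q) Q s"
  using assms unfolding wp_def by (meson terminates_in.seq)

lemma wp_seq_set [simp]:
  "wp (PSeq (PISet v a b) q) Q s \<longleftrightarrow> wp q Q (iput v (ival a s) (ival b s) s)"
  "wp (PSeq (PRSet v a e) q) Q s \<longleftrightarrow> wp q Q (rput v (ival a s) (rval e s) s)"
  unfolding wp_def by (auto elim!: seqE isetE rsetE intro: terminates_in.intros)

lemma wp_mono:
  assumes "wp p Q s" "\<And>t. Q t \<Longrightarrow> R t"
  shows "wp p R s"
  using assms unfolding wp_def by blast

text \<open>The invariant carries its own variant: the natural number \<open>k\<close> has to drop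
  in each iteration.\<close>

lemma wp_while:
  fixes I :: "nat \<Rightarrow> mem \<Rightarrow> bool"
  assumes "I k s" "\<And>k t. I k t \<Longrightarrow> holds b t \<Longrightarrow> wp p (\<lambda>u. \<exists>l<k. I l u) t"
  shows "wp (PWhile b p) (\<lambda>t. (\<exists>k. I k t) \<and> \<not> holds b t) s"
  using assms(1)
proof (induction k arbitrary: s rule: less_induct)
  case (less k)
  show ?case
  proof (cases "holds b s")
    case True
    then obtain t l where t: "terminates_in p s t" "l < k" "I l t"
      using assms(2)[OF less.prems] unfolding wp_def by blast
    then show ?thesis
      using less.IH[of l t] True unfolding wp_def by (meson terminates_in.while_true)
  next
    case False
    then show ?thesis using less.prems unfolding wp_def by (meson terminates_in.while_false)
  qed
qed

section \<open>Frames and counting loops\<close>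

primrec ivars :: "prog \<Rightarrow> string set" where
  "ivars PSkip = {}"
| "ivars (PISet v a b) = {v}"
| "ivars (PRSet v a b) = {}"
| "ivars (PSeq p q) = ivars p \<union> ivars q"
| "ivars (PIf b p q) = ivars p \<union> ivars q"
| "ivars (PWhile b p) = ivars p"

primrec rvars :: "prog \<Rightarrow> string set" where
  "rvars PSkip = {}"
| "rvars (PISet v a b) = {}"
| "rvars (PRSet v a b) = {v}"
| "rvars (PSeq p q) = rvars p \<union> rvars q"
| "rvars (PIf b p q) = rvars p \<union> rvars q"
| "rvars (PWhile b p) = rvars p"

text \<open>Changes are tracked per array, not per cell. The search never writes to an input array,
  so this is precise enough to keep the instance intact in every loop.\<close>

definition frame :: "prog \<Rightarrow> mem \<Rightarrow> mem \<Rightarrow> bool" where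
  "frame p s t \<longleftrightarrow>
     (\<forall>v. v \<notin> ivars p \<longrightarrow> imem t v = imem s v) \<and> (\<forall>v. v \<notin> rvars p \<longrightarrow> rmem t v = rmem s v)"

lemma iput_simps [simp]:
  "imem (iput v k z s) = (imem s)(v := (imem s v)(k := z))"
  "rmem (iput v k z s) = rmem s"
  by (simp_all add: iput_def)

lemma rput_simps [simp]:
  "rmem (rput v k z s) = (rmem s)(v := (rmem s v)(k := z))"
  "imem (rput v k z s) = imem s"
  by (simp_all add: rput_def)

lemma terminates_in_frame: "terminates_in p s t \<Longrightarrow> frame p s t"
  by (induction rule: terminates_in.induct) (auto simp: frame_def)

lemma wp_frame: "wp p Q s \<Longrightarrow> wp p (\<lambda>t. frame p s t \<and> Q t) s"
  unfolding wp_def using terminates_in_frame by blast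

abbreviation scalar :: "string \<Rightarrow> iexp" where
  "scalar v \<equiv> ICell v (IConst 0)"

abbreviation set_scalar :: "string \<Rightarrow> iexp \<Rightarrow> prog" where
  "set_scalar v \<equiv> PISet v (IConst 0)"

definition for_loop :: "string \<Rightarrow> string \<Rightarrow> prog \<Rightarrow> prog" where
  "for_loop v b p = PSeq (set_scalar v (IConst 0))
     (PWhile (ILess (scalar v) (scalar b)) (PSeq p (set_scalar v (IAdd (scalar v) (IConst 1)))))"

lemma for_loop_vars [simp]:
  "ivars (for_loop v b p) = insert v (ivars p)" "rvars (for_loop v b p) = rvars p"
  by (auto simp: for_loop_def)

text \<open>The counter is updated outside the body, so \<open>I\<close> must survive writes to it
  (\<open>indep\<close>). The frame back to \<open>s\<close> lets \<open>step\<close> use facts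
  about the initial memory without putting them into \<open>I\<close>.\<close>

lemma wp_for_loop:
  fixes I :: "nat \<Rightarrow> mem \<Rightarrow> bool"
  assumes b: "imem s b 0 = int N" "b \<notin> ivars p" "b \<noteq> v" and v: "v \<notin> ivars p"
    and init: "I 0 s"
    and step: "\<And>j t. j < N \<Longrightarrow> frame (for_loop v b p) s t \<Longrightarrow> imem t v 0 = int j \<Longrightarrow> I j t \<Longrightarrow> wp p (I (Suc j)) t"
    and indep: "\<And>j t z. I j t \<Longrightarrow> I j (iput v 0 z t)"
  shows "wp (for_loop v b p) (\<lambda>t. frame (for_loop v b p) s t \<and> I N t) s"
proof -
  define Inv where "Inv k t \<longleftrightarrow> (\<exists>j\<le>N. k = N - j \<and> imem t v 0 = int j \<and> I j t \<and>
    frame (for_loop v b p) s t)" for k t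
  let ?b = "ILess (scalar v) (scalar b)" and ?q = "PSeq p (set_scalar v (IAdd (scalar v) (IConst 1)))"
  have "wp (PWhile ?b ?q) (\<lambda>t. (\<exists>k. Inv k t) \<and> \<not> holds ?b t) (iput v 0 0 s)"
  proof (rule wp_while)
    show "Inv N (iput v 0 0 s)"
      unfolding Inv_def using indep[OF init] by (intro exI[of _ 0]) (auto simp: frame_def)
    fix k t assume "Inv k t" and h: "holds ?b t"
    then obtain j where j: "k = N - j" "imem t v 0 = int j" "I j t" "frame (for_loop v b p) s t"
      by (auto simp: Inv_def)
    have "imem t b 0 = int N" using j(4) b by (simp add: frame_def)
    then have "j < N" using h j(2) by simp
    have "wp p (\<lambda>u. frame p t u \<and> I (Suc j) u) t"
      by (rule wp_frame) (rule step[OF \<open>j < N\<close> j(4,2,3)])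
    then show "wp ?q (\<lambda>u. \<exists>l<k. Inv l u) t"
    proof (rule wp_seqI)
      fix u assume u: "frame p t u \<and> I (Suc j) u"
      then have "imem u v 0 = int j" using j(2) v by (simp add: frame_def)
      moreover have "frame (for_loop v b p) s u" using u j(4) by (auto simp: frame_def)
      ultimately have "Inv (N - Suc j) (iput v 0 (1 + int j) u)"
        unfolding Inv_def using u \<open>j < N\<close> indep
        by (intro exI[of _ "Suc j"]) (auto simp: frame_def)
      moreover have "N - Suc j < k" using \<open>j < N\<close> j(1) by linarith
      ultimately have "\<exists>l<k. Inv l (iput v 0 (1 + int j) u)" by blast
      then show "wp (set_scalar v (IAdd (scalar v) (IConst 1))) (\<lambda>u. \<exists>l<k. Inv l u) u"
        using \<open>imem u v 0 = int j\<close> by (simp add: add.commute)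
    qed
  qed
  then have "wp (PWhile ?b ?q) (\<lambda>t. frame (for_loop v b p) s t \<and> I N t) (iput v 0 0 s)"
  proof (rule wp_mono)
    fix t assume t: "(\<exists>k. Inv k t) \<and> \<not> holds ?b t"
    then obtain j where j: "j \<le> N" "imem t v 0 = int j" "I j t" "frame (for_loop v b p) s t"
      by (auto simp: Inv_def)
    have "imem t b 0 = int N" using j(4) b by (simp add: frame_def)
    then have "j = N" using t j(1,2) by simp
    then show "frame (for_loop v b p) s t \<and> I N t" using j by blast
  qed
  then show ?thesis
    unfolding for_loop_def by simp
qed

definition sum_loop :: "string \<Rightarrow> string \<Rightarrow> string \<Rightarrow> iexp \<Rightarrow> prog" where
  "sum_loop acc v b e = PSeq (set_scalar acc (IConst 0))
     (for_loop v b (set_scalar acc (IAdd (scalar acc) e)))"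

lemma sum_loop_vars [simp]: "ivars (sum_loop acc v b e) = {acc, v}" "rvars (sum_loop acc v b e) = {}"
  by (auto simp: sum_loop_def)

lemma wp_sum_loop:
  assumes "imem s b 0 = int N" "distinct [acc, v, b]"
    and e: "\<And>j t. j < N \<Longrightarrow> frame (sum_loop acc v b e) s t \<Longrightarrow> imem t v 0 = int j \<Longrightarrow> ival e t = f j"
  shows "wp (sum_loop acc v b e)
    (\<lambda>t. frame (sum_loop acc v b e) s t \<and> imem t acc 0 = (\<Sum>j<N. f j)) s"
proof (rule wp_frame)
  let ?s = "iput acc 0 0 s"
  have "wp (for_loop v b (set_scalar acc (IAdd (scalar acc) e)))
    (\<lambda>t. frame (for_loop v b (set_scalar acc (IAdd (scalar acc) e))) ?s t \<and> imem t acc 0 = (\<Sum>j<N. f j)) ?s"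
  proof (rule wp_for_loop)
    fix j t assume "j < N" "frame (for_loop v b (set_scalar acc (IAdd (scalar acc) e))) ?s t"
      "imem t v 0 = int j" and sum: "imem t acc 0 = (\<Sum>j<j. f j)"
    then have "ival e t = f j" by (intro e) (auto simp: frame_def)
    then show "wp (set_scalar acc (IAdd (scalar acc) e)) (\<lambda>t. imem t acc 0 = (\<Sum>j<Suc j. f j)) t"
      using sum by simp
  qed (use assms in auto)
  then show "wp (sum_loop acc v b e) (\<lambda>t. imem t acc 0 = (\<Sum>j<N. f j)) s"
    unfolding sum_loop_def
    by (auto elim: wp_mono)
qed


section \<open>Exhaustive search\<close>

text \<open>Row and column variables are fixed so that one expression serves the column sums of
  \<open>slack_prog\<close> and the row sums of \<open>row_loop\<close>.\<close>

definition matrix_cell :: "string \<Rightarrow> iexp" where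
  "matrix_cell v = ICell v (IAdd (IMul (scalar ''a'') (scalar ''n'')) (scalar ''j''))"

text \<open>The column sums of the degree matrix count the constraints on an element, so this
  computes \<open>\<Delta> - 1\<close>; starting from 0 performs the truncation.\<close>

definition slack_prog :: prog where
  "slack_prog = PSeq (set_scalar ''D'' (IConst 0))
     (for_loop ''j'' ''n'' (PSeq (sum_loop ''acc'' ''a'' ''k'' (matrix_cell ''E''))
       (PIf (ILess (scalar ''D'') (ISub (scalar ''acc'') (IConst 1)))
         (set_scalar ''D'' (ISub (scalar ''acc'') (IConst 1))) PSkip)))"

definition row_loop :: "string \<Rightarrow> string \<Rightarrow> test \<Rightarrow> prog" where
  "row_loop mx nr violated = for_loop ''a'' nr (PSeq
     (sum_loop ''acc'' ''j'' ''n'' (IMul (matrix_cell mx) (ICell ''y'' (scalar ''j''))))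
     (PIf violated (set_scalar ''ok'' (IConst 0)) PSkip))"

definition check_prog :: prog where
  "check_prog = PSeq (set_scalar ''ok'' (IConst 1)) (PSeq
     (row_loop ''rho'' ''m'' (ILess (scalar ''acc'') (ICell ''r'' (scalar ''a''))))
     (row_loop ''E'' ''k'' (ILess (IAdd (ICell ''b'' (scalar ''a'')) (scalar ''D'')) (scalar ''acc''))))"

definition cost_prog :: prog where
  "cost_prog = PSeq (PRSet ''cost'' (IConst 0) (ROfInt (IConst 0)))
     (for_loop ''j'' ''n'' (PRSet ''cost'' (IConst 0) (RAdd (RCell ''cost'' (IConst 0))
       (RMul (RCell ''c'' (scalar ''j'')) (ROfInt (ICell ''y'' (scalar ''j'')))))))"

definition save_prog :: prog where
  "save_prog = PSeq (set_scalar ''found'' (IConst 1))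
     (PSeq (PRSet ''best'' (IConst 0) (RCell ''cost'' (IConst 0)))
       (for_loop ''j'' ''n'' (PISet ''x'' (scalar ''j'') (ICell ''y'' (scalar ''j'')))))"

text \<open>Binary increment of \<open>''y''\<close>, cell 0 being the least significant bit.
  Overflow means that all vectors have been seen and lowers \<open>''go''\<close>.\<close>

definition next_prog :: prog where
  "next_prog = PSeq (set_scalar ''i'' (IConst 0)) (PSeq
     (PWhile (TAnd (ILess (scalar ''i'') (scalar ''n'')) (ILess (IConst 0) (ICell ''y'' (scalar ''i''))))
       (PSeq (PISet ''y'' (scalar ''i'') (IConst 0)) (set_scalar ''i'' (IAdd (scalar ''i'') (IConst 1)))))
     (PIf (ILess (scalar ''i'') (scalar ''n''))
       (PISet ''y'' (scalar ''i'') (IConst 1)) (set_scalar ''go'' (IConst 0))))"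

text \<open>A disjunction in negated form: before the first success \<open>''best''\<close> is
  arbitrary and must not influence the outcome.\<close>

definition better :: test where
  "better = TAnd (ILess (IConst 0) (scalar ''ok''))
     (TNot (TAnd (ILess (IConst 0) (scalar ''found''))
       (TNot (RLess (RCell ''cost'' (IConst 0)) (RCell ''best'' (IConst 0))))))"

definition search_body :: prog where
  "search_body = PSeq check_prog (PSeq cost_prog (PSeq (PIf better save_prog PSkip) next_prog))"

definition search_prog :: prog where
  "search_prog = PSeq slack_prog (PSeq (for_loop ''j'' ''n'' (PISet ''y'' (scalar ''j'') (IConst 0)))
     (PSeq (set_scalar ''found'' (IConst 0)) (PSeq (set_scalar ''go'' (IConst 1))
       (PWhile (ILess (IConst 0) (scalar ''go'')) search_body))))"

lemma prog_vars [simp]: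
  "ivars slack_prog = {''D'', ''j'', ''acc'', ''a''}" "rvars slack_prog = {}"
  "ivars (row_loop mx nr violated) = {''a'', ''acc'', ''j'', ''ok''}" "rvars (row_loop mx nr violated) = {}"
  "ivars check_prog = {''ok'', ''a'', ''acc'', ''j''}" "rvars check_prog = {}"
  "ivars cost_prog = {''j''}" "rvars cost_prog = {''cost''}"
  "ivars save_prog = {''found'', ''j'', ''x''}" "rvars save_prog = {''best''}"
  "ivars next_prog = {''i'', ''y'', ''go''}" "rvars next_prog = {}"
  by (auto simp: slack_prog_def row_loop_def check_prog_def cost_prog_def save_prog_def next_prog_def)

section \<open>What the parts of the program compute\<close>

definition row_sum :: "mem \<Rightarrow> string \<Rightarrow> nat \<Rightarrow> nat \<Rightarrow> nat set \<Rightarrow> int" where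
  "row_sum s v n a Z = (\<Sum>j<n. imem s v (int (a * n + j)) * of_bool (j \<in> Z))"

definition max_slack :: "mem \<Rightarrow> nat \<Rightarrow> nat \<Rightarrow> int" where
  "max_slack s n k = Max (insert 0 ((\<lambda>j. (\<Sum>a<k. imem s ''E'' (int (a * n + j))) - 1) ` {..<n}))"

definition acceptable :: "mem \<Rightarrow> nat \<Rightarrow> nat \<Rightarrow> nat \<Rightarrow> int \<Rightarrow> nat set \<Rightarrow> bool" where
  "acceptable s n m k D Z \<longleftrightarrow>
     (\<forall>a<m. imem s ''r'' (int a) \<le> row_sum s ''rho'' n a Z) \<and>
     (\<forall>a<k. row_sum s ''E'' n a Z \<le> imem s ''b'' (int a) + D)"

definition total_cost :: "mem \<Rightarrow> nat \<Rightarrow> nat set \<Rightarrow> real" where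
  "total_cost s n Z = (\<Sum>j<n. rmem s ''c'' (int j) * of_bool (j \<in> Z))"

definition encodes :: "mem \<Rightarrow> string \<Rightarrow> nat \<Rightarrow> nat set \<Rightarrow> bool" where
  "encodes s v n Z \<longleftrightarrow> (\<forall>j<n. imem s v (int j) = of_bool (j \<in> Z))"

lemma wp_slack_prog:
  assumes "imem s ''n'' 0 = int n" "imem s ''k'' 0 = int k"
  shows "wp slack_prog (\<lambda>t. frame slack_prog s t \<and> imem t ''D'' 0 = max_slack s n k) s"
proof (rule wp_frame)
  define f where "f j = (\<Sum>a<k. imem s ''E'' (int (a * n + j))) - 1" for j
  let ?s = "iput ''D'' 0 0 s"
  let ?S = "sum_loop ''acc'' ''a'' ''k'' (matrix_cell ''E'')"
  let ?I = "PIf (ILess (scalar ''D'') (ISub (scalar ''acc'') (IConst 1)))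
    (set_scalar ''D'' (ISub (scalar ''acc'') (IConst 1))) PSkip"
  let ?p = "PSeq ?S ?I"
  have "wp (for_loop ''j'' ''n'' ?p) (\<lambda>t. frame (for_loop ''j'' ''n'' ?p) ?s t \<and>
    imem t ''D'' 0 = Max (insert 0 (f ` {..<n}))) ?s"
  proof (rule wp_for_loop)
    fix j t
    assume j: "j < n" and fr: "frame (for_loop ''j'' ''n'' ?p) ?s t" and tj: "imem t ''j'' 0 = int j"
      and D: "imem t ''D'' 0 = Max (insert 0 (f ` {..<j}))"
    have "wp ?S (\<lambda>u. frame ?S t u \<and> imem u ''acc'' 0 = (\<Sum>a<k. imem s ''E'' (int (a * n + j)))) t"
      by (rule wp_sum_loop) (use assms fr tj in \<open>auto simp: frame_def matrix_cell_def\<close>)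
    then show "wp ?p (\<lambda>t. imem t ''D'' 0 = Max (insert 0 (f ` {..<Suc j}))) t"
    proof (rule wp_seqI)
      fix u assume "frame ?S t u \<and> imem u ''acc'' 0 = (\<Sum>a<k. imem s ''E'' (int (a * n + j)))"
      then have u: "imem u ''D'' 0 = Max (insert 0 (f ` {..<j}))" "imem u ''acc'' 0 - 1 = f j"
        using D by (auto simp: frame_def f_def)
      define M where "M = Max (insert 0 (f ` {..<j}))"
      have "Max (insert 0 (f ` {..<Suc j})) = max (f j) M"
        unfolding M_def
        by (simp add: lessThan_Suc insert_commute[of 0] del: Max_insert) (subst Max_insert, auto)
      then show "wp ?I (\<lambda>t. imem t ''D'' 0 = Max (insert 0 (f ` {..<Suc j}))) u"
        using u unfolding M_def[symmetric] by auto
    qed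
  qed (use assms in auto)
  then show "wp slack_prog (\<lambda>t. imem t ''D'' 0 = max_slack s n k) s"
    unfolding slack_prog_def max_slack_def f_def
    by (auto elim: wp_mono)
qed

text \<open>The flag is only ever lowered, so consecutive passes form a conjunction; the incoming
  flag therefore appears in the result.\<close>

lemma wp_row_loop:
  assumes "imem s ''n'' 0 = int n" "imem s nr 0 = int m" "encodes s ''y'' n Y"
    and "nr \<notin> {''a'', ''acc'', ''j'', ''ok''}" "mx \<notin> {''a'', ''acc'', ''j'', ''ok''}"
    and violated: "\<And>a t. a < m \<Longrightarrow> frame (row_loop mx nr violated) s t \<Longrightarrow> imem t ''a'' 0 = int a \<Longrightarrow>
      imem t ''acc'' 0 = row_sum s mx n a Y \<Longrightarrow> holds violated t \<longleftrightarrow> \<not> P a"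
  shows "wp (row_loop mx nr violated) (\<lambda>t. frame (row_loop mx nr violated) s t \<and>
    imem t ''ok'' 0 = (if \<forall>a<m. P a then imem s ''ok'' 0 else 0)) s"
proof -
  let ?S = "sum_loop ''acc'' ''j'' ''n'' (IMul (matrix_cell mx) (ICell ''y'' (scalar ''j'')))"
  let ?I = "PIf violated (set_scalar ''ok'' (IConst 0)) PSkip"
  show ?thesis
    unfolding row_loop_def
  proof (rule wp_for_loop)
    fix a t
    assume a: "a < m" and fr: "frame (for_loop ''a'' nr (PSeq ?S ?I)) s t" and ta: "imem t ''a'' 0 = int a"
      and ok: "imem t ''ok'' 0 = (if \<forall>b<a. P b then imem s ''ok'' 0 else 0)"
    have "wp ?S (\<lambda>u. frame ?S t u \<and> imem u ''acc'' 0 =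
        (\<Sum>j<n. imem s mx (int (a * n + j)) * of_bool (j \<in> Y))) t"
      by (rule wp_sum_loop) (use assms(1-5) fr ta in \<open>auto simp: frame_def matrix_cell_def encodes_def\<close>)
    then show "wp (PSeq ?S ?I) (\<lambda>t. imem t ''ok'' 0 = (if \<forall>b<Suc a. P b then imem s ''ok'' 0 else 0)) t"
    proof (rule wp_seqI)
      fix u assume u: "frame ?S t u \<and> imem u ''acc'' 0 =
        (\<Sum>j<n. imem s mx (int (a * n + j)) * of_bool (j \<in> Y))"
      have "frame (row_loop mx nr violated) s u" using fr u by (auto simp: frame_def)
      moreover have "imem u ''a'' 0 = int a" using u ta by (simp add: frame_def)
      ultimately have "holds violated u \<longleftrightarrow> \<not> P a" using violated[OF a] u by (simp add: row_sum_def)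
      moreover have "imem u ''ok'' 0 = imem t ''ok'' 0" using u by (simp add: frame_def)
      ultimately show "wp ?I (\<lambda>t. imem t ''ok'' 0 = (if \<forall>b<Suc a. P b then imem s ''ok'' 0 else 0)) u"
        using ok by (auto simp: less_Suc_eq)
    qed
  qed (use assms in auto)
qed

lemma wp_check_prog:
  assumes "imem s ''n'' 0 = int n" "imem s ''m'' 0 = int m" "imem s ''k'' 0 = int k" "encodes s ''y'' n Y"
  shows "wp check_prog (\<lambda>t. frame check_prog s t \<and>
    imem t ''ok'' 0 = of_bool (acceptable s n m k (imem s ''D'' 0) Y)) s"
proof (rule wp_frame)
  let ?s = "iput ''ok'' 0 1 s"
  let ?v1 = "ILess (scalar ''acc'') (ICell ''r'' (scalar ''a''))"
  let ?v2 = "ILess (IAdd (ICell ''b'' (scalar ''a'')) (scalar ''D'')) (scalar ''acc'')"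
  let ?p1 = "row_loop ''rho'' ''m'' ?v1" and ?p2 = "row_loop ''E'' ''k'' ?v2"
  let ?P1 = "\<lambda>a. imem s ''r'' (int a) \<le> row_sum s ''rho'' n a Y"
  let ?P2 = "\<lambda>a. row_sum s ''E'' n a Y \<le> imem s ''b'' (int a) + imem s ''D'' 0"
  have "wp ?p1 (\<lambda>t. frame ?p1 ?s t \<and> imem t ''ok'' 0 = (if \<forall>a<m. ?P1 a then imem ?s ''ok'' 0 else 0)) ?s"
    by (rule wp_row_loop[where n = n and Y = Y]) (use assms in \<open>auto simp: encodes_def frame_def row_sum_def not_le\<close>)
  moreover have "wp ?p2 (\<lambda>u. imem u ''ok'' 0 = of_bool (acceptable s n m k (imem s ''D'' 0) Y)) t"
    if t: "frame ?p1 ?s t \<and> imem t ''ok'' 0 = (if \<forall>a<m. ?P1 a then imem ?s ''ok'' 0 else 0)" for t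
  proof -
    have "wp ?p2 (\<lambda>u. frame ?p2 t u \<and> imem u ''ok'' 0 = (if \<forall>a<k. ?P2 a then imem t ''ok'' 0 else 0)) t"
      by (rule wp_row_loop[where n = n and Y = Y]) (use assms t in \<open>auto simp: encodes_def frame_def row_sum_def not_le\<close>)
    then show ?thesis by (rule wp_mono) (use t in \<open>auto simp: acceptable_def\<close>)
  qed
  ultimately have "wp (PSeq ?p1 ?p2) (\<lambda>u. imem u ''ok'' 0 = of_bool (acceptable s n m k (imem s ''D'' 0) Y)) ?s"
    by (rule wp_seqI)
  then show "wp check_prog (\<lambda>t. imem t ''ok'' 0 = of_bool (acceptable s n m k (imem s ''D'' 0) Y)) s"
    unfolding check_prog_def by simp
qed

lemma wp_cost_prog:
  assumes "imem s ''n'' 0 = int n" "encodes s ''y'' n Y"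
  shows "wp cost_prog (\<lambda>t. frame cost_prog s t \<and> rmem t ''cost'' 0 = total_cost s n Y) s"
proof (rule wp_frame)
  let ?s = "rput ''cost'' 0 0 s"
  let ?p = "PRSet ''cost'' (IConst 0) (RAdd (RCell ''cost'' (IConst 0))
    (RMul (RCell ''c'' (scalar ''j'')) (ROfInt (ICell ''y'' (scalar ''j'')))))"
  have "wp (for_loop ''j'' ''n'' ?p) (\<lambda>t. frame (for_loop ''j'' ''n'' ?p) ?s t \<and>
    rmem t ''cost'' 0 = total_cost s n Y) ?s"
    unfolding total_cost_def
    by (rule wp_for_loop) (use assms in \<open>auto simp: frame_def encodes_def\<close>)
  then show "wp cost_prog (\<lambda>t. rmem t ''cost'' 0 = total_cost s n Y) s"
    unfolding cost_prog_def by (auto elim: wp_mono)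
qed

lemma wp_save_prog:
  assumes "imem s ''n'' 0 = int n" "encodes s ''y'' n Y"
  shows "wp save_prog (\<lambda>t. frame save_prog s t \<and> encodes t ''x'' n Y \<and>
    imem t ''found'' 0 = 1 \<and> rmem t ''best'' 0 = rmem s ''cost'' 0) s"
proof (rule wp_frame)
  let ?s = "rput ''best'' 0 (rmem s ''cost'' 0) (iput ''found'' 0 1 s)"
  let ?p = "PISet ''x'' (scalar ''j'') (ICell ''y'' (scalar ''j''))"
  have "wp (for_loop ''j'' ''n'' ?p) (\<lambda>t. frame (for_loop ''j'' ''n'' ?p) ?s t \<and> encodes t ''x'' n Y) ?s"
  proof -
    have "wp (for_loop ''j'' ''n'' ?p) (\<lambda>t. frame (for_loop ''j'' ''n'' ?p) ?s t \<and>
      (\<forall>i<n. imem t ''x'' (int i) = of_bool (i \<in> Y))) ?s"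
      by (rule wp_for_loop) (use assms in \<open>auto simp: frame_def encodes_def less_Suc_eq\<close>)
    then show ?thesis by (simp only: encodes_def)
  qed
  then have "wp (for_loop ''j'' ''n'' ?p) (\<lambda>t. encodes t ''x'' n Y \<and>
    imem t ''found'' 0 = 1 \<and> rmem t ''best'' 0 = rmem s ''cost'' 0) ?s"
    by (rule wp_mono) (auto simp: frame_def)
  then show "wp save_prog (\<lambda>t. encodes t ''x'' n Y \<and>
    imem t ''found'' 0 = 1 \<and> rmem t ''best'' 0 = rmem s ''cost'' 0) s"
    unfolding save_prog_def
    by simp
qed

section \<open>Counting in binary\<close>

lemma set_encode_lessThan: "Suc (set_encode {..<i}) = 2 ^ i"
  by (induction i) (auto simp: set_encode_def lessThan_Suc)

text \<open>Binary increment: a block of trailing ones is cleared and the next bit is set.\<close>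
lemma set_encode_increment:
  assumes "finite Y" "{..<i} \<subseteq> Y" "i \<notin> Y"
  shows "set_encode (insert i (Y - {..<i})) = Suc (set_encode Y)"
proof -
  have "set_encode Y = set_encode {..<i} + set_encode (Y - {..<i})"
    unfolding set_encode_def using assms sum.subset_diff[of "{..<i}" Y "(^) 2"] by (simp add: add.commute)
  moreover have "set_encode (insert i (Y - {..<i})) = 2 ^ i + set_encode (Y - {..<i})"
    using assms by (simp add: set_encode_insert)
  ultimately show ?thesis using set_encode_lessThan[of i] by simp
qed

lemma wp_next_prog:
  assumes n: "imem s ''n'' 0 = int n" and Y: "encodes s ''y'' n Y" "Y \<subseteq> {..<n}"
  shows "wp next_prog (\<lambda>t. frame next_prog s t \<and>
    ((imem t ''go'' 0 = imem s ''go'' 0 \<and> (\<exists>Z\<subseteq>{..<n}. encodes t ''y'' n Z \<and> set_encode Z = Suc (set_encode Y))) \<or>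
     (imem t ''go'' 0 = 0 \<and> Y = {..<n}))) s"
proof (rule wp_frame)
  let ?s = "iput ''i'' 0 0 s"
  let ?b = "TAnd (ILess (scalar ''i'') (scalar ''n'')) (ILess (IConst 0) (ICell ''y'' (scalar ''i'')))"
  let ?p = "PSeq (PISet ''y'' (scalar ''i'') (IConst 0)) (set_scalar ''i'' (IAdd (scalar ''i'') (IConst 1)))"
  let ?q = "PIf (ILess (scalar ''i'') (scalar ''n''))
       (PISet ''y'' (scalar ''i'') (IConst 1)) (set_scalar ''go'' (IConst 0))"
  let ?Q = "\<lambda>t. (imem t ''go'' 0 = imem s ''go'' 0 \<and>
      (\<exists>Z\<subseteq>{..<n}. encodes t ''y'' n Z \<and> set_encode Z = Suc (set_encode Y))) \<or>
     (imem t ''go'' 0 = 0 \<and> Y = {..<n})"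
  \<comment> \<open>The first \<open>i\<close> bits were ones and are cleared by now; the variant is
    \<open>n - i\<close>.\<close>
  define I where "I l t \<longleftrightarrow> (\<exists>i\<le>n. l = n - i \<and> imem t ''i'' 0 = int i \<and> imem t ''n'' 0 = int n \<and>
    imem t ''go'' 0 = imem s ''go'' 0 \<and> {..<i} \<subseteq> Y \<and> encodes t ''y'' n (Y - {..<i}))" for l t
  have "wp (PWhile ?b ?p) (\<lambda>t. (\<exists>l. I l t) \<and> \<not> holds ?b t) ?s"
  proof (rule wp_while)
    show "I n ?s" unfolding I_def using n Y by (intro exI[of _ 0]) (auto simp: encodes_def)
    fix l t assume "I l t" "holds ?b t"
    then obtain i where i: "i \<le> n" "l = n - i" "imem t ''i'' 0 = int i" "imem t ''n'' 0 = int n"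
      "imem t ''go'' 0 = imem s ''go'' 0" "{..<i} \<subseteq> Y" "encodes t ''y'' n (Y - {..<i})"
      by (auto simp: I_def)
    with \<open>holds ?b t\<close> have "i < n" "i \<in> Y" by (auto simp: encodes_def split: if_splits)
    let ?t = "iput ''y'' (int i) 0 t"
    let ?u = "iput ''i'' 0 (int i + 1) ?t"
    have "I (n - Suc i) ?u"
      unfolding I_def using i \<open>i < n\<close> \<open>i \<in> Y\<close>
      by (intro exI[of _ "Suc i"]) (auto simp: encodes_def less_Suc_eq lessThan_Suc)
    then have "\<exists>l'<l. I l' ?u" using \<open>i < n\<close> i(2) by (intro exI[of _ "n - Suc i"]) auto
    then show "wp ?p (\<lambda>u. \<exists>l'<l. I l' u) t"
      using i(3) by simp
  qed
  moreover have "wp ?q ?Q t" if t: "(\<exists>l. I l t) \<and> \<not> holds ?b t" for t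
  proof -
    obtain i where i: "i \<le> n" "imem t ''i'' 0 = int i" "imem t ''n'' 0 = int n"
      "imem t ''go'' 0 = imem s ''go'' 0" "{..<i} \<subseteq> Y" "encodes t ''y'' n (Y - {..<i})"
      using t by (auto simp: I_def)
    show ?thesis
    proof (cases "i < n")
      case True
      \<comment> \<open>The scan stopped inside the vector, so it met a zero bit.\<close>
      then have "i \<notin> Y" using t i(2,3,6) by (auto simp: encodes_def)
      let ?Z = "insert i (Y - {..<i})"
      have "set_encode ?Z = Suc (set_encode Y)"
        using finite_subset[OF Y(2)] i(5) \<open>i \<notin> Y\<close> by (intro set_encode_increment) auto
      moreover have "encodes (iput ''y'' (int i) 1 t) ''y'' n ?Z" using i(6) by (auto simp: encodes_def)
      moreover have "?Z \<subseteq> {..<n}" using True Y(2) by auto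
      ultimately have "?Q (iput ''y'' (int i) 1 t)" using i(4) by auto
      then show ?thesis using True i(2,3) by simp
    next
      case False
      then have "Y = {..<n}" using i(1,5) Y(2) by auto
      then show ?thesis using False i(2,3) by simp
    qed
  qed
  ultimately have "wp (PSeq (PWhile ?b ?p) ?q) ?Q ?s" by (rule wp_seqI)
  then show "wp next_prog ?Q s"
    unfolding next_prog_def by simp
qed

text \<open>\<open>V\<close> holds the candidates visited so far. While \<open>''found''\<close> is
  0, nothing is claimed about \<open>''x''\<close> and \<open>''best''\<close>.\<close>

definition best_among :: "(nat set \<Rightarrow> bool) \<Rightarrow> (nat set \<Rightarrow> real) \<Rightarrow> nat \<Rightarrow> nat set set \<Rightarrow> mem \<Rightarrow> bool" where
  "best_among ok cost n V t \<longleftrightarrow>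
     (imem t ''found'' 0 = 0 \<and> (\<forall>Z\<in>V. \<not> ok Z)) \<or>
     (imem t ''found'' 0 = 1 \<and> (\<exists>B. ok B \<and> encodes t ''x'' n B \<and> rmem t ''best'' 0 = cost B \<and>
       (\<forall>Z\<in>V. ok Z \<longrightarrow> cost B \<le> cost Z)))"

lemma set_encode_less:
  assumes "Y \<subseteq> {..<n}"
  shows "set_encode Y < 2 ^ n"
proof -
  have "set_encode Y \<le> set_encode {..<n}" unfolding set_encode_def using assms by (intro sum_mono2) auto
  then show ?thesis using set_encode_lessThan[of n] by linarith
qed

lemma wp_search_body:
  assumes n: "imem s ''n'' 0 = int n" "imem s ''m'' 0 = int m" "imem s ''k'' 0 = int k"
    and Y: "encodes s ''y'' n Y" "Y \<subseteq> {..<n}"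
    and best: "best_among (acceptable s n m k (imem s ''D'' 0)) (total_cost s n) n V s"
  shows "wp search_body (\<lambda>t. frame search_body s t \<and>
    best_among (acceptable s n m k (imem s ''D'' 0)) (total_cost s n) n (insert Y V) t \<and>
    ((imem t ''go'' 0 = imem s ''go'' 0 \<and> (\<exists>Z\<subseteq>{..<n}. encodes t ''y'' n Z \<and> set_encode Z = Suc (set_encode Y))) \<or>
     (imem t ''go'' 0 = 0 \<and> Y = {..<n}))) s"
proof (rule wp_frame)
  let ?ok = "acceptable s n m k (imem s ''D'' 0)" and ?cost = "total_cost s n"
  let ?best = "best_among ?ok ?cost n"
  let ?save = "PIf better save_prog PSkip"
  let ?Q = "\<lambda>t. ?best (insert Y V) t \<and> ((imem t ''go'' 0 = imem s ''go'' 0 \<and>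
      (\<exists>Z\<subseteq>{..<n}. encodes t ''y'' n Z \<and> set_encode Z = Suc (set_encode Y))) \<or>
     (imem t ''go'' 0 = 0 \<and> Y = {..<n}))"
  have check: "wp check_prog (\<lambda>t. frame check_prog s t \<and> imem t ''ok'' 0 = of_bool (?ok Y)) s"
    by (rule wp_check_prog) fact+
  show "wp search_body ?Q s"
    unfolding search_body_def
  proof (rule wp_seqI[OF check])
    fix t1 assume t1: "frame check_prog s t1 \<and> imem t1 ''ok'' 0 = of_bool (?ok Y)"
    have "wp cost_prog (\<lambda>t. frame cost_prog t1 t \<and> rmem t ''cost'' 0 = total_cost t1 n Y) t1"
      by (rule wp_cost_prog) (use n(1) Y(1) t1 in \<open>auto simp: frame_def encodes_def\<close>)
    then show "wp (PSeq cost_prog (PSeq ?save next_prog)) ?Q t1"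
    proof (rule wp_seqI)
      fix t2 assume t2: "frame cost_prog t1 t2 \<and> rmem t2 ''cost'' 0 = total_cost t1 n Y"
      have cost: "rmem t2 ''cost'' 0 = ?cost Y" using t1 t2 by (simp add: frame_def total_cost_def)
      have ok: "imem t2 ''ok'' 0 = of_bool (?ok Y)" using t1 t2 by (simp add: frame_def)
      have same: "imem t2 ''found'' 0 = imem s ''found'' 0" "rmem t2 ''best'' 0 = rmem s ''best'' 0"
        "imem t2 ''n'' 0 = int n" "encodes t2 ''y'' n Y" "imem t2 ''go'' 0 = imem s ''go'' 0"
        using t1 t2 n Y by (auto simp: frame_def encodes_def)
      have best2: "?best V t2" using best t1 t2 by (simp add: best_among_def frame_def encodes_def)
      have "wp ?save (\<lambda>t. frame ?save t2 t \<and> ?best (insert Y V) t) t2"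
      proof (rule wp_frame, cases "holds better t2")
        case True
        then have "?ok Y" "imem t2 ''found'' 0 \<le> 0 \<or> rmem t2 ''cost'' 0 < rmem t2 ''best'' 0"
          using ok by (auto simp: better_def split: if_splits)
        \<comment> \<open>If nothing was found, no member of \<open>V\<close> is acceptable;
          otherwise \<open>Y\<close> beats the stored set, which is no costlier than the
          rest.\<close>
        then have "\<forall>Z\<in>insert Y V. ?ok Z \<longrightarrow> ?cost Y \<le> ?cost Z"
          using best2 cost by (force simp: best_among_def)
        moreover have "wp save_prog (\<lambda>t. frame save_prog t2 t \<and> encodes t ''x'' n Y \<and>
          imem t ''found'' 0 = 1 \<and> rmem t ''best'' 0 = rmem t2 ''cost'' 0) t2"
          by (rule wp_save_prog) fact+
        ultimately have "wp save_prog (?best (insert Y V)) t2"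
          using \<open>?ok Y\<close> cost by (elim wp_mono) (auto simp: best_among_def)
        then show "wp ?save (?best (insert Y V)) t2" using True by simp
      next
        case False
        then have "\<not> ?ok Y \<or> (0 < imem t2 ''found'' 0 \<and> rmem t2 ''best'' 0 \<le> ?cost Y)"
          using ok cost by (auto simp: better_def split: if_splits)
        then have "?best (insert Y V) t2" using best2 by (auto simp: best_among_def)
        then show "wp ?save (?best (insert Y V)) t2" using False by simp
      qed
      then show "wp (PSeq ?save next_prog) ?Q t2"
      proof (rule wp_seqI)
        fix t3 assume t3: "frame ?save t2 t3 \<and> ?best (insert Y V) t3"
        have "wp next_prog (\<lambda>t. frame next_prog t3 t \<and> ((imem t ''go'' 0 = imem t3 ''go'' 0 \<and>
            (\<exists>Z\<subseteq>{..<n}. encodes t ''y'' n Z \<and> set_encode Z = Suc (set_encode Y))) \<or>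
           (imem t ''go'' 0 = 0 \<and> Y = {..<n}))) t3"
          by (rule wp_next_prog) (use t3 same Y(2) in \<open>auto simp: frame_def encodes_def\<close>)
        then show "wp next_prog ?Q t3"
          by (rule wp_mono) (use t3 same in \<open>auto simp: frame_def best_among_def encodes_def\<close>)
      qed
    qed
  qed
qed

lemma search_body_vars [simp]:
  "ivars search_body = {''ok'', ''a'', ''acc'', ''j'', ''found'', ''x'', ''i'', ''y'', ''go''}"
  "rvars search_body = {''cost'', ''best''}"
  by (auto simp: search_body_def)

lemma wp_search_prog:
  assumes n: "imem s ''n'' 0 = int n" "imem s ''m'' 0 = int m" "imem s ''k'' 0 = int k"
  shows "wp search_prog (best_among (acceptable s n m k (max_slack s n k)) (total_cost s n) n (Pow {..<n})) s"
proof -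
  let ?ok = "acceptable s n m k (max_slack s n k)" and ?cost = "total_cost s n"
  let ?best = "best_among ?ok ?cost n"
  let ?clear = "for_loop ''j'' ''n'' (PISet ''y'' (scalar ''j'') (IConst 0))"
  let ?loop = "PWhile (ILess (IConst 0) (scalar ''go'')) search_body"
  let ?V = "\<lambda>Y. {Z. Z \<subseteq> {..<n} \<and> set_encode Z < set_encode Y}"
  \<comment> \<open>During the search the visited sets are those with a smaller code than
    \<open>Y\<close>, and \<open>2 ^ n - set_encode Y\<close> is positive; the value 0 is left for
    the final state.\<close>
  define I where "I l t \<longleftrightarrow> imem t ''D'' 0 = max_slack s n k \<and>
    (\<forall>v\<in>{''n'', ''m'', ''k'', ''r'', ''rho'', ''b'', ''E''}. imem t v = imem s v) \<and> rmem t ''c'' = rmem s ''c'' \<and>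
    ((imem t ''go'' 0 = 1 \<and> (\<exists>Y\<subseteq>{..<n}. encodes t ''y'' n Y \<and> ?best (?V Y) t \<and> l = 2 ^ n - set_encode Y)) \<or>
     (imem t ''go'' 0 = 0 \<and> ?best (Pow {..<n}) t \<and> l = 0))" for l :: nat and t
  show ?thesis
    unfolding search_prog_def
  proof (rule wp_seqI[OF wp_slack_prog[OF n(1,3)]])
    fix t1 assume t1: "frame slack_prog s t1 \<and> imem t1 ''D'' 0 = max_slack s n k"
    have "wp ?clear (\<lambda>t. frame ?clear t1 t \<and> (\<forall>i<n. imem t ''y'' (int i) = of_bool (i \<in> {}))) t1"
      by (rule wp_for_loop) (use n(1) t1 in \<open>auto simp: frame_def less_Suc_eq\<close>)
    then show "wp (PSeq ?clear (PSeq (set_scalar ''found'' (IConst 0)) (PSeq (set_scalar ''go'' (IConst 1)) ?loop)))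
      (?best (Pow {..<n})) t1"
    proof (rule wp_seqI)
      fix t2 assume t2: "frame ?clear t1 t2 \<and> (\<forall>i<n. imem t2 ''y'' (int i) = of_bool (i \<in> {}))"
      let ?t3 = "iput ''go'' 0 1 (iput ''found'' 0 0 t2)"
      have "wp ?loop (\<lambda>t. (\<exists>l. I l t) \<and> \<not> holds (ILess (IConst 0) (scalar ''go'')) t) ?t3"
      proof (rule wp_while)
        \<comment> \<open>The empty set has code 0, so nothing counts as visited.\<close>
        have "?best (?V {}) ?t3" by (simp add: best_among_def)
        moreover have "imem ?t3 ''go'' 0 = 1" "rmem ?t3 ''c'' = rmem s ''c''" "encodes ?t3 ''y'' n {}"
          "imem ?t3 ''D'' 0 = max_slack s n k"
          "\<forall>v\<in>{''n'', ''m'', ''k'', ''r'', ''rho'', ''b'', ''E''}. imem ?t3 v = imem s v"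
          using t1 t2 by (simp_all add: frame_def encodes_def)
        ultimately show "I (2 ^ n - set_encode {}) ?t3" unfolding I_def by blast
      next
        fix l t assume "I l t" and h: "holds (ILess (IConst 0) (scalar ''go'')) t"
        then obtain Y where Y: "Y \<subseteq> {..<n}" "encodes t ''y'' n Y" "?best (?V Y) t" "l = 2 ^ n - set_encode Y"
          and go: "imem t ''go'' 0 = 1" by (auto simp: I_def)
        have D: "imem t ''D'' 0 = max_slack s n k"
          and inp: "\<forall>v\<in>{''n'', ''m'', ''k'', ''r'', ''rho'', ''b'', ''E''}. imem t v = imem s v" "rmem t ''c'' = rmem s ''c''"
          using \<open>I l t\<close> by (auto simp: I_def)
        have ok: "acceptable t n m k (imem t ''D'' 0) = ?ok" "total_cost t n = ?cost"
          using inp D by (auto simp: fun_eq_iff acceptable_def row_sum_def total_cost_def)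
        have "wp search_body (\<lambda>u. frame search_body t u \<and>
          best_among (acceptable t n m k (imem t ''D'' 0)) (total_cost t n) n (insert Y (?V Y)) u \<and>
          ((imem u ''go'' 0 = imem t ''go'' 0 \<and> (\<exists>Z\<subseteq>{..<n}. encodes u ''y'' n Z \<and> set_encode Z = Suc (set_encode Y))) \<or>
           (imem u ''go'' 0 = 0 \<and> Y = {..<n}))) t"
          by (rule wp_search_body) (use Y inp n ok in auto)
        then show "wp search_body (\<lambda>u. \<exists>l'<l. I l' u) t"
        proof (rule wp_mono)
          fix u assume u: "frame search_body t u \<and>
            best_among (acceptable t n m k (imem t ''D'' 0)) (total_cost t n) n (insert Y (?V Y)) u \<and>
            ((imem u ''go'' 0 = imem t ''go'' 0 \<and> (\<exists>Z\<subseteq>{..<n}. encodes u ''y'' n Z \<and> set_encode Z = Suc (set_encode Y))) \<or>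
             (imem u ''go'' 0 = 0 \<and> Y = {..<n}))"
          have inp': "imem u ''D'' 0 = max_slack s n k"
            "\<forall>v\<in>{''n'', ''m'', ''k'', ''r'', ''rho'', ''b'', ''E''}. imem u v = imem s v" "rmem u ''c'' = rmem s ''c''"
            using u D inp by (auto simp: frame_def)
          \<comment> \<open>\<open>set_encode\<close> is injective on finite sets, so
            \<open>Y\<close> is the only set with its code.\<close>
          have eqY: "insert Y (?V Y) = {Z. Z \<subseteq> {..<n} \<and> set_encode Z \<le> set_encode Y}"
            using Y(1) set_encode_eq by (auto simp: le_less dest: finite_subset)
          have best: "?best {Z. Z \<subseteq> {..<n} \<and> set_encode Z \<le> set_encode Y} u"
            using u unfolding ok eqY by blast
          from u consider (next_set) Z where "imem u ''go'' 0 = 1" "Z \<subseteq> {..<n}" "encodes u ''y'' n Z"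
              "set_encode Z = Suc (set_encode Y)"
            | (last_set) "imem u ''go'' 0 = 0" "Y = {..<n}" using go by auto
          then show "\<exists>l'<l. I l' u"
          proof cases
            case next_set
            have "?best (?V Z) u" using best next_set(4) by (simp add: less_Suc_eq_le)
            then have "I (2 ^ n - set_encode Z) u" unfolding I_def using inp' next_set by blast
            moreover have "2 ^ n - set_encode Z < l"
              using next_set(4) Y(4) set_encode_less[OF Y(1)] by simp
            ultimately show ?thesis by blast
          next
            case last_set
            \<comment> \<open>The full set has the largest code, so overflow means that every subset
              was visited.\<close>
            have "{Z. Z \<subseteq> {..<n} \<and> set_encode Z \<le> set_encode Y} = Pow {..<n}"
              using last_set(2) by (auto simp: set_encode_def intro: sum_mono2)
            then have "I 0 u" unfolding I_def using inp' last_set(1) best by simp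
            moreover have "0 < l" using Y(4) set_encode_less[OF Y(1)] by simp
            ultimately show ?thesis by blast
          qed
        qed
      qed
      then have "wp ?loop (?best (Pow {..<n})) ?t3"
        by (rule wp_mono) (auto simp: I_def)
      then show "wp (PSeq (set_scalar ''found'' (IConst 0)) (PSeq (set_scalar ''go'' (IConst 1)) ?loop))
        (?best (Pow {..<n})) t2"
        by simp
    qed
  qed
qed


section \<open>Memory contents and instances\<close>

text \<open>The program sees the ground set only through the order of \<open>es\<close>, so its
  candidates are sets of positions.\<close>

definition selection :: "'e list \<Rightarrow> nat set \<Rightarrow> 'e \<Rightarrow> real" where
  "selection es Z e = of_bool (\<exists>j<length es. j \<in> Z \<and> es ! j = e)"

lemma selection_nth:
  assumes "distinct es" "j < length es"
  shows "selection es Z (es ! j) = of_bool (j \<in> Z)"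
  using assms by (auto simp: selection_def nth_eq_iff_index_eq)

lemma sum_subset_nth:
  fixes x :: "'e \<Rightarrow> 'b::comm_semiring_1"
  assumes "distinct es" "A \<subseteq> set es"
  shows "sum x A = (\<Sum>j<length es. of_bool (es ! j \<in> A) * x (es ! j))"
proof -
  have "(\<Sum>j<length es. of_bool (es ! j \<in> A) * x (es ! j)) = (\<Sum>e\<in>set es. of_bool (e \<in> A) * x e)"
    using bij_betw_nth[OF assms(1) refl refl] by (rule sum.reindex_bij_betw)
  also have "\<dots> = (\<Sum>e\<in>A. x e)"
    using assms(2) by (intro sum.mono_neutral_cong_right) auto
  finally show ?thesis ..
qed

context
  fixes L :: "('f, 'e, 'i) clp" and es fs js s
  assumes inst: "clp_instance L" and loaded: "clp_loaded L es fs js s"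
begin

lemma loaded_lists:
  "distinct es" "set es = clp_ground L" "distinct fs" "set fs = clp_family L" "distinct js" "set js = clp_index L"
  using loaded by (simp_all add: clp_loaded_def)

lemma sets_in_ground:
  "S \<in> clp_family L \<Longrightarrow> clp_rho L S \<subseteq> set es" "i \<in> clp_index L \<Longrightarrow> clp_deg_set L i \<subseteq> set es"
  using inst loaded_lists by (simp_all add: clp_instance_def)

lemma row_sum_rho:
  assumes "a < length fs"
  shows "of_int (row_sum s ''rho'' (length es) a Z) = sum (selection es Z) (clp_rho L (fs ! a))"
proof -
  have "fs ! a \<in> clp_family L" using assms loaded_lists by (metis nth_mem)
  then have "sum (selection es Z) (clp_rho L (fs ! a)) =
    (\<Sum>j<length es. of_bool (es ! j \<in> clp_rho L (fs ! a)) * selection es Z (es ! j))"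
    using loaded_lists(1) sets_in_ground(1) by (intro sum_subset_nth)
  also have "\<dots> = of_int (row_sum s ''rho'' (length es) a Z)"
    using assms loaded loaded_lists(1) by (auto simp: row_sum_def clp_loaded_def selection_nth intro!: sum.cong)
  finally show ?thesis ..
qed

lemma row_sum_E:
  assumes "a < length js"
  shows "of_int (row_sum s ''E'' (length es) a Z) = sum (selection es Z) (clp_deg_set L (js ! a))"
proof -
  have "js ! a \<in> clp_index L" using assms loaded_lists by (metis nth_mem)
  then have "sum (selection es Z) (clp_deg_set L (js ! a)) =
    (\<Sum>j<length es. of_bool (es ! j \<in> clp_deg_set L (js ! a)) * selection es Z (es ! j))"
    using loaded_lists(1) sets_in_ground(2) by (intro sum_subset_nth)
  also have "\<dots> = of_int (row_sum s ''E'' (length es) a Z)"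
    using assms loaded loaded_lists(1) by (auto simp: row_sum_def clp_loaded_def selection_nth intro!: sum.cong)
  finally show ?thesis ..
qed

lemma total_cost_selection: "total_cost s (length es) Z = clp_cost L (selection es Z)"
proof -
  have "clp_cost L (selection es Z) = (\<Sum>j<length es. clp_weight L (es ! j) * selection es Z (es ! j))"
    unfolding clp_cost_def loaded_lists(2)[symmetric]
    by (rule sum.reindex_bij_betw[symmetric]) (rule bij_betw_nth[OF loaded_lists(1) refl refl])
  also have "\<dots> = total_cost s (length es) Z"
    using loaded loaded_lists(1) by (simp add: total_cost_def clp_loaded_def selection_nth)
  finally show ?thesis ..
qed

text \<open>For \<open>\<Delta> = 0\<close> the maximum is the inserted 0; otherwise
  \<open>\<Delta>\<close> is attained at some element, whose column sum gives
  \<open>\<Delta> - 1\<close>.\<close>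

lemma max_slack_Delta:
  "real_of_int (max_slack s (length es) (length js)) = max 0 (real (clp_Delta L) - 1)"
proof -
  define deg where "deg e = card {i \<in> clp_index L. e \<in> clp_deg_set L i}" for e
  have col: "(\<Sum>a<length js. imem s ''E'' (int (a * length es + j))) = int (deg (es ! j))" if "j < length es" for j
  proof -
    have "{i \<in> clp_index L. es ! j \<in> clp_deg_set L i} \<subseteq> set js" using loaded_lists(6) by auto
    then have "(\<Sum>i\<in>{i \<in> clp_index L. es ! j \<in> clp_deg_set L i}. 1::int) =
      (\<Sum>a<length js. of_bool (js ! a \<in> {i \<in> clp_index L. es ! j \<in> clp_deg_set L i}) * 1)"
      by (rule sum_subset_nth[OF loaded_lists(5)])
    also have "\<dots> = (\<Sum>a<length js. imem s ''E'' (int (a * length es + j)))"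
    proof (rule sum.cong[OF refl])
      fix a assume "a \<in> {..<length js}"
      moreover from this have "js ! a \<in> clp_index L" using loaded_lists(6) by (metis lessThan_iff nth_mem)
      ultimately show "of_bool (js ! a \<in> {i \<in> clp_index L. es ! j \<in> clp_deg_set L i}) * 1 =
          imem s ''E'' (int (a * length es + j))"
        using loaded that by (simp add: clp_loaded_def)
    qed
    finally show ?thesis by (simp add: deg_def)
  qed
  have Delta: "clp_Delta L = Max (insert 0 (deg ` set es))"
    unfolding clp_Delta_def deg_def loaded_lists(2) ..
  have "max_slack s (length es) (length js) = max 0 (int (clp_Delta L) - 1)"
    unfolding max_slack_def
  proof (rule Max_eqI)
    let ?f = "\<lambda>j. (\<Sum>a<length js. imem s ''E'' (int (a * length es + j))) - 1"
    show "finite (insert 0 (?f ` {..<length es}))" by simp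
    have "deg (es ! j) \<le> clp_Delta L" if "j < length es" for j
      unfolding Delta using that by (intro Max_ge) auto
    then show "y \<le> max 0 (int (clp_Delta L) - 1)" if "y \<in> insert 0 (?f ` {..<length es})" for y
      using that col by (fastforce simp: le_max_iff_disj)
    show "max 0 (int (clp_Delta L) - 1) \<in> insert 0 (?f ` {..<length es})"
    proof (cases "clp_Delta L = 0")
      case False
      have "clp_Delta L \<in> insert 0 (deg ` set es)" unfolding Delta by (intro Max_in) auto
      then obtain j where "j < length es" "clp_Delta L = deg (es ! j)"
        using False by (auto simp: in_set_conv_nth)
      then have "int (clp_Delta L) - 1 \<in> ?f ` {..<length es}" using col by (intro image_eqI[of _ _ j]) auto
      then show ?thesis using False by (simp add: max_def)
    qed simp
  qed
  then show ?thesis by (simp add: of_int_max)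
qed

text \<open>The program compares integers and the specification compares reals; both sides of every
  test are integral, so the embedding preserves the answers.\<close>

lemma acceptable_iff:
  "acceptable s (length es) (length fs) (length js) (max_slack s (length es) (length js)) Z \<longleftrightarrow>
     clp_near_feasible L (selection es Z)"
proof -
  have rank: "imem s ''r'' (int a) \<le> row_sum s ''rho'' (length es) a Z \<longleftrightarrow>
      real (clp_rank L (fs ! a)) \<le> sum (selection es Z) (clp_rho L (fs ! a))" if "a < length fs" for a
  proof -
    have "imem s ''r'' (int a) = int (clp_rank L (fs ! a))" using that loaded by (simp add: clp_loaded_def)
    then have "imem s ''r'' (int a) \<le> row_sum s ''rho'' (length es) a Z \<longleftrightarrow>
      real_of_int (int (clp_rank L (fs ! a))) \<le> of_int (row_sum s ''rho'' (length es) a Z)"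
      unfolding of_int_le_iff by simp
    then show ?thesis using row_sum_rho[OF that] by simp
  qed
  have degree: "row_sum s ''E'' (length es) a Z \<le> imem s ''b'' (int a) + max_slack s (length es) (length js) \<longleftrightarrow>
      sum (selection es Z) (clp_deg_set L (js ! a)) \<le> of_int (clp_bound L (js ! a)) + max 0 (real (clp_Delta L) - 1)"
    if "a < length js" for a
  proof -
    have "imem s ''b'' (int a) = clp_bound L (js ! a)" using that loaded by (simp add: clp_loaded_def)
    then have "row_sum s ''E'' (length es) a Z \<le> imem s ''b'' (int a) + max_slack s (length es) (length js) \<longleftrightarrow>
      real_of_int (row_sum s ''E'' (length es) a Z) \<le> of_int (clp_bound L (js ! a) + max_slack s (length es) (length js))"
      unfolding of_int_le_iff by simp
    then show ?thesis using row_sum_E[OF that] max_slack_Delta by simp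
  qed
  have "(\<forall>a<length fs. real (clp_rank L (fs ! a)) \<le> sum (selection es Z) (clp_rho L (fs ! a))) \<longleftrightarrow>
      clp_rank_ok L (selection es Z)"
    unfolding clp_rank_ok_def loaded_lists(4)[symmetric] all_set_conv_all_nth ..
  moreover have "selection es Z \<in> clp_ground L \<rightarrow> {0, 1}" by (auto simp: selection_def)
  ultimately show ?thesis
    unfolding acceptable_def clp_near_feasible_def loaded_lists(6)[symmetric] all_set_conv_all_nth
    using rank degree by simp
qed

text \<open>Near feasibility and cost depend only on values on the ground set, and there a 0/1
  vector is given by the positions of its ones.\<close>

lemma near_feasible_selection:
  assumes x: "clp_near_feasible L x"
  shows "\<exists>Z\<subseteq>{..<length es}. clp_near_feasible L (selection es Z) \<and> clp_cost L (selection es Z) = clp_cost L x"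
proof -
  define Z where "Z = {j. j < length es \<and> x (es ! j) = 1}"
  have eq: "selection es Z e = x e" if e: "e \<in> set es" for e
  proof -
    have "x e = 0 \<or> x e = 1" using x e loaded_lists(2) by (auto simp: clp_near_feasible_def)
    moreover obtain j where "j < length es" "e = es ! j" using e by (auto simp: in_set_conv_nth)
    ultimately show ?thesis using selection_nth[OF loaded_lists(1)] by (auto simp: Z_def)
  qed
  have sum_eq: "sum (selection es Z) A = sum x A" if "A \<subseteq> set es" for A
    using that eq by (intro sum.cong) auto
  have "clp_near_feasible L (selection es Z)"
    using x sum_eq[OF sets_in_ground(1)] sum_eq[OF sets_in_ground(2)] eq
    by (simp add: clp_near_feasible_def clp_rank_ok_def Pi_iff loaded_lists(2))
  moreover have "clp_cost L (selection es Z) = clp_cost L x"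
    unfolding clp_cost_def using eq loaded_lists(2) by (intro sum.cong) auto
  ultimately show ?thesis by (intro exI[of _ Z]) (auto simp: Z_def)
qed

end

theorem theorem6:
  shows "\<exists>P :: prog. \<forall>(L :: ('f, 'e, 'i) clp) es fs js s.
    clp_instance L \<and> clp_inclusion_ordered L \<and> clp_loaded L es fs js s \<longrightarrow>
    (\<exists>t. terminates_in P s t \<and>
      (clp_feasible L {0..1} \<noteq> {} \<longrightarrow>
        (\<exists>x. clp_output es t x \<and> clp_near_feasible L x \<and>
           clp_cost L x \<le> clp_opt L {0..1} \<and>
           (clp_feasible L {0, 1} \<noteq> {} \<longrightarrow> clp_cost L x \<le> clp_opt L {0, 1}))))"
proof (intro exI[of _ search_prog] allI impI)
  fix L :: "('f, 'e, 'i) clp" and es fs js s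
  assume "clp_instance L \<and> clp_inclusion_ordered L \<and> clp_loaded L es fs js s"
  then have L: "clp_instance L" "clp_inclusion_ordered L" and loaded: "clp_loaded L es fs js s" by auto
  let ?n = "length es" and ?m = "length fs" and ?k = "length js"
  let ?ok = "acceptable s ?n ?m ?k (max_slack s ?n ?k)" and ?x = "selection es"
  note ok_iff = acceptable_iff[OF L(1) loaded] and cost_eq = total_cost_selection[OF L(1) loaded]
  have "wp search_prog (best_among ?ok (total_cost s ?n) ?n (Pow {..<?n})) s"
    using loaded by (intro wp_search_prog) (simp_all add: clp_loaded_def)
  then obtain t where t: "terminates_in search_prog s t" "best_among ?ok (total_cost s ?n) ?n (Pow {..<?n}) t"
    unfolding wp_def by blast
  \<comment> \<open>The only use of rounding: it guarantees a cheap enough candidate for the search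
    to find.\<close>
  have candidate: "\<exists>Z\<in>Pow {..<?n}. ?ok Z \<and> total_cost s ?n Z \<le> clp_cost L x" if x: "x \<in> clp_feasible L {0..1}" for x
  proof -
    obtain y where "clp_near_feasible L y" "clp_cost L y \<le> clp_cost L x"
      using near_feasible_below_fractional[OF L x] by blast
    then show ?thesis using near_feasible_selection[OF L(1) loaded, of y] ok_iff cost_eq by force
  qed
  have "\<exists>x. clp_output es t x \<and> clp_near_feasible L x \<and> clp_cost L x \<le> clp_opt L {0..1} \<and>
      (clp_feasible L {0, 1} \<noteq> {} \<longrightarrow> clp_cost L x \<le> clp_opt L {0, 1})"
    if nonempty: "clp_feasible L {0..1} \<noteq> {}"
  proof -
    have "\<exists>Z\<in>Pow {..<?n}. ?ok Z" using nonempty candidate by blast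
    then obtain B where B: "?ok B" "encodes t ''x'' ?n B"
      "\<forall>Z\<in>Pow {..<?n}. ?ok Z \<longrightarrow> total_cost s ?n B \<le> total_cost s ?n Z"
      using t(2) unfolding best_among_def by blast
    \<comment> \<open>The bound holds at each fractional point, so it passes to the infimum.\<close>
    have le: "clp_cost L (?x B) \<le> clp_cost L x" if "x \<in> clp_feasible L {0..1}" for x
      using candidate[OF that] B(3) cost_eq by force
    \<comment> \<open>0/1 solutions are points of the relaxation, so the same bound covers the
      integral optimum.\<close>
    have "clp_feasible L {0, 1} \<subseteq> clp_feasible L {0..1}"
      by (force simp: clp_feasible_def Pi_iff)
    then have "clp_feasible L {0, 1} \<noteq> {} \<longrightarrow> clp_cost L (?x B) \<le> clp_opt L {0, 1}"
      unfolding clp_opt_def using le by (blast intro: cINF_greatest)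
    moreover have "clp_cost L (?x B) \<le> clp_opt L {0..1}"
      unfolding clp_opt_def using nonempty le by (intro cINF_greatest)
    moreover have "clp_output es t (?x B)"
      using B(2) loaded by (simp add: clp_output_def encodes_def selection_nth clp_loaded_def)
    ultimately show ?thesis using B(1) ok_iff by blast
  qed
  then show "\<exists>t. terminates_in search_prog s t \<and> (clp_feasible L {0..1} \<noteq> {} \<longrightarrow>
      (\<exists>x. clp_output es t x \<and> clp_near_feasible L x \<and> clp_cost L x \<le> clp_opt L {0..1} \<and>
         (clp_feasible L {0, 1} \<noteq> {} \<longrightarrow> clp_cost L x \<le> clp_opt L {0, 1})))"
    using t(1) by blast
qed

end
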